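(* Let $C > 0$ be a real constant and let $\alpha = A/B \in \mathbb{Q}_{>0}$ with positive integers $A, B$ satisfying $\gcd(A,B) = 1$. Let $y(t)$ be the solution, with values in $[0,1)$ for $t \ge 0$, of the initial value problem $$\dot{y} = C(1 - y^\alpha), \qquad y(0) = 0.$$ Then $y(t)$ is an elementary function if and only if $\alpha \in \{1, 2\}$. The corresponding explicit solutions are $$\alpha = 1: \quad y(t) = 1 - \exp(-Ct), \qquad\qquad \alpha = 2: \quad y(t) = \tanh(Ct).$$
   Context: A function of one variable $t$ is elementary if it can be obtained from constants and the variable $t$ by finitely many applications of algebraic operations (arithmetic operations and solving polynomial equations, i.e. algebraic functions), exponentials and logarithms; equivalently, it lies in a differential field obtained from $\mathbb{C}(t)$ by a finite tower of algebraic, exponential and logarithmic extensions. *)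

theory Defs
  imports "HOL-Complex_Analysis.Complex_Analysis"
begin

(* Elementary functions on a fixed domain (nonempty connected open set) D of the complex plane:
   the functions obtained from complex constants and the variable by finitely many arithmetic
   operations, solutions of polynomial equations, exponentials and logarithms.  Logarithms and
   algebraic functions are multivalued, so their rules admit every holomorphic branch on D.
   In the algebraic rule, the equation must be nontrivial over the functions on D, i.e. not all
   coefficients vanish identically on D; since D is meant to be connected, this is the usual
   notion of being algebraic over the field of quotients.  Values outside D are irrelevant. *)
inductive elementary_holo :: "complex set \<Rightarrow> (complex \<Rightarrow> complex) \<Rightarrow> bool" for D where
  const: "elementary_holo D (\<lambda>z. c)"
| ident: "elementary_holo D (\<lambda>z. z)"
| add: "elementary_holo D f \<Longrightarrow> elementary_holo D g \<Longrightarrow> elementary_holo D (\<lambda>z. f z + g z)"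
| diff: "elementary_holo D f \<Longrightarrow> elementary_holo D g \<Longrightarrow> elementary_holo D (\<lambda>z. f z - g z)"
| mult: "elementary_holo D f \<Longrightarrow> elementary_holo D g \<Longrightarrow> elementary_holo D (\<lambda>z. f z * g z)"
| divide: "elementary_holo D f \<Longrightarrow> elementary_holo D g \<Longrightarrow> \<forall>z\<in>D. g z \<noteq> 0 \<Longrightarrow>
    elementary_holo D (\<lambda>z. f z / g z)"
| algebraic: "\<forall>i\<le>n. elementary_holo D (c i) \<Longrightarrow> \<exists>i\<le>n. \<exists>z\<in>D. c i z \<noteq> 0 \<Longrightarrow>
    f holomorphic_on D \<Longrightarrow> \<forall>z\<in>D. (\<Sum>i\<le>n. c i z * f z ^ i) = 0 \<Longrightarrow> elementary_holo D f"
| exponential: "elementary_holo D f \<Longrightarrow> elementary_holo D (\<lambda>z. exp (f z))"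
| logarithm: "elementary_holo D g \<Longrightarrow> f holomorphic_on D \<Longrightarrow> \<forall>z\<in>D. exp (f z) = g z \<Longrightarrow>
    elementary_holo D f"

(* A real function on a real interval J is elementary there if it is the restriction to J of an
   elementary function on some complex domain containing J. *)
definition elementary_on :: "real set \<Rightarrow> (real \<Rightarrow> real) \<Rightarrow> bool" where
  "elementary_on J f \<longleftrightarrow> (\<exists>D F. open D \<and> connected D \<and> complex_of_real ` J \<subseteq> D \<and>
     elementary_holo D F \<and> (\<forall>t\<in>J. F (complex_of_real t) = complex_of_real (f t)))"

end

(* The function s = y^(1/B) satisfies B s^(B-1) s' = C (1 - s^A), a differential equation v(s) s' = u(s)
   with constant coefficients.  Suppose y is elementary.  The Taylor expansion of s at a point of the
   interval then lies in a tower of differential fields, each of which is the relative algebraic closure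
   of K(theta), with K the preceding field and theta a logarithm or an exponential over K.  At the first
   step where s appears, s is transcendental over K, and by exchange theta is algebraic over the
   differential field K(s).  A coefficient of its minimal polynomial is a rational function q = P/Q in s,
   not in K, which is again a logarithm or an exponential over K.  Comparing the two parts of D q shows
   that (u/v) dq/ds or (u/v) (dq/ds)/q, respectively, is a nonzero constant g.  In the first case g v/u
   is the derivative of a rational function, although its residue at s = 1 is nonzero.  In the second
   case g v/u is a logarithmic derivative, so its residues, -g B w^B / (C A) at the A-th roots of unity w,
   are integers; hence w^B is rational for all w, so A divides 2, and since a logarithmic derivative
   vanishes at infinity, B <= A. *)
theory Submission
  imports Defs
begin

section \<open>Algebraic closure of a subfield\<close>

text \<open>The equation for \<open>y\<close> contains a fractional power, whereas the one for
  \<open>s\<close> is autonomous and rational. All fields are subfields of one ambient field, the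
  Laurent series at a point: the identity theorem embeds the holomorphic functions on a connected
  domain into it, and quotients need no discussion of poles. The obstacle is that the coefficients
  of P and Q are arbitrary elements of K, so D q mixes their derivatives with the part that comes
  from D s. Differentiating the relation for D q once more, coefficientwise, separates the two: it
  shows that the ratio formed from the second part is a constant. Being a constant, this ratio lies
  in K, so its defining equation at the transcendental \<open>s\<close> becomes an identity of
  polynomials, and residues and degrees can be compared.\<close>

definition is_subring :: "'a::field set \<Rightarrow> bool" where
  "is_subring L \<longleftrightarrow> 0 \<in> L \<and> 1 \<in> L \<and> (\<forall>x\<in>L. \<forall>y\<in>L. x + y \<in> L \<and> x * y \<in> L)"

definition is_subfield :: "'a::field set \<Rightarrow> bool" where
  "is_subfield K \<longleftrightarrow> is_subring K \<and> (\<forall>x\<in>K. - x \<in> K \<and> inverse x \<in> K)"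

definition polys :: "'a::zero set \<Rightarrow> 'a poly set" where
  "polys K = {p. \<forall>i. coeff p i \<in> K}"

definition acl :: "'a::field set \<Rightarrow> 'a set" where
  "acl K = {x. \<exists>p\<in>polys K. p \<noteq> 0 \<and> poly p x = 0}"

lemma is_subringD:
  assumes "is_subring L"
  shows "0 \<in> L" "1 \<in> L" "x \<in> L \<Longrightarrow> y \<in> L \<Longrightarrow> x + y \<in> L" "x \<in> L \<Longrightarrow> y \<in> L \<Longrightarrow> x * y \<in> L"
  using assms by (auto simp: is_subring_def)

lemma is_subfieldD:
  assumes "is_subfield K"
  shows "is_subring K" "0 \<in> K" "1 \<in> K" "x \<in> K \<Longrightarrow> y \<in> K \<Longrightarrow> x + y \<in> K"
    "x \<in> K \<Longrightarrow> y \<in> K \<Longrightarrow> x * y \<in> K" "x \<in> K \<Longrightarrow> - x \<in> K" "x \<in> K \<Longrightarrow> inverse x \<in> K"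
    "x \<in> K \<Longrightarrow> y \<in> K \<Longrightarrow> x - y \<in> K" "x \<in> K \<Longrightarrow> y \<in> K \<Longrightarrow> x / y \<in> K"
proof -
  note * = assms[unfolded is_subfield_def is_subring_def]
  show "is_subring K" "0 \<in> K" "1 \<in> K" "x \<in> K \<Longrightarrow> y \<in> K \<Longrightarrow> x + y \<in> K"
    "x \<in> K \<Longrightarrow> y \<in> K \<Longrightarrow> x * y \<in> K" "x \<in> K \<Longrightarrow> - x \<in> K" "x \<in> K \<Longrightarrow> inverse x \<in> K"
    using assms * by (auto simp: is_subfield_def)
  show "x \<in> K \<Longrightarrow> y \<in> K \<Longrightarrow> x - y \<in> K"
    unfolding diff_conv_add_uminus using * by blast
  show "x \<in> K \<Longrightarrow> y \<in> K \<Longrightarrow> x / y \<in> K"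
    unfolding divide_inverse using * by blast
qed

lemma is_subring_sum:
  assumes "is_subring L" "\<And>i. i \<in> I \<Longrightarrow> f i \<in> L"
  shows "sum f I \<in> L"
  using assms(2) by (induction I rule: infinite_finite_induct) (auto intro: is_subringD[OF assms(1)])

lemma is_subring_power: "is_subring L \<Longrightarrow> x \<in> L \<Longrightarrow> x ^ n \<in> L"
  by (induction n) (auto intro: is_subringD)

lemma is_subring_of_nat: "is_subring L \<Longrightarrow> of_nat n \<in> L"
  by (induction n) (auto intro: is_subringD)

section \<open>Polynomials with coefficients in a subring\<close>

lemma polys_0: "0 \<in> L \<Longrightarrow> 0 \<in> polys L"
  by (auto simp: polys_def)

lemma polys_pCons: "pCons a p \<in> polys L \<longleftrightarrow> a \<in> L \<and> p \<in> polys L"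
proof
  assume *: "pCons a p \<in> polys L"
  then have "coeff (pCons a p) 0 \<in> L" "\<And>i. coeff (pCons a p) (Suc i) \<in> L"
    by (auto simp only: polys_def mem_Collect_eq)
  then show "a \<in> L \<and> p \<in> polys L" by (auto simp: polys_def)
qed (auto simp: polys_def coeff_pCons split: nat.splits)

lemma polys_const: "is_subring L \<Longrightarrow> a \<in> L \<Longrightarrow> [:a:] \<in> polys L"
  by (simp add: polys_pCons polys_0 is_subringD)

lemma polys_1: "is_subring L \<Longrightarrow> 1 \<in> polys L"
  unfolding one_pCons by (rule polys_const) (auto intro: is_subringD)

lemma polys_add: "is_subring L \<Longrightarrow> p \<in> polys L \<Longrightarrow> q \<in> polys L \<Longrightarrow> p + q \<in> polys L"
  by (auto simp: polys_def intro: is_subringD)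

lemma polys_mult: "is_subring L \<Longrightarrow> p \<in> polys L \<Longrightarrow> q \<in> polys L \<Longrightarrow> p * q \<in> polys L"
  by (auto simp: polys_def coeff_mult intro!: is_subring_sum intro: is_subringD)

lemma polys_smult: "is_subring L \<Longrightarrow> a \<in> L \<Longrightarrow> p \<in> polys L \<Longrightarrow> smult a p \<in> polys L"
  by (auto simp: polys_def intro: is_subringD)

lemma polys_uminus: "is_subfield K \<Longrightarrow> p \<in> polys K \<Longrightarrow> - p \<in> polys K"
  by (auto simp: polys_def intro: is_subfieldD)

lemma polys_diff: "is_subfield K \<Longrightarrow> p \<in> polys K \<Longrightarrow> q \<in> polys K \<Longrightarrow> p - q \<in> polys K"
  by (auto simp: polys_def intro: is_subfieldD)

lemma polys_pderiv: "is_subring L \<Longrightarrow> p \<in> polys L \<Longrightarrow> pderiv p \<in> polys L"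
  by (auto simp: polys_def coeff_pderiv
      intro: is_subringD(4) is_subring_of_nat simp del: of_nat_Suc)

lemma polys_mono: "K \<subseteq> L \<Longrightarrow> polys K \<subseteq> polys L"
  by (auto simp: polys_def)

lemma poly_in_subring:
  assumes "is_subring L" "p \<in> polys L" "x \<in> L"
  shows "poly p x \<in> L"
  using assms(2) by (induction p) (auto simp: polys_pCons intro: is_subringD[OF assms(1)] assms(3))

lemma subset_acl:
  assumes "is_subfield K"
  shows "K \<subseteq> acl K"
proof
  fix x assume "x \<in> K"
  then have "[:- x, 1:] \<in> polys K"
    using is_subfieldD[OF assms] by (simp add: polys_pCons polys_0)
  moreover have "poly [:- x, 1:] x = 0" by simp
  ultimately show "x \<in> acl K" unfolding acl_def by (intro CollectI bexI[of _ "[:- x, 1:]"]) simp_all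
qed

section \<open>Spans over a subfield and finite ring extensions\<close>

lemma underdetermined_system:
  fixes a :: "'j \<Rightarrow> 'i \<Rightarrow> 'a::field"
  assumes K: "is_subfield K" and "finite I" "finite J" "card I < card J"
    and "\<And>i j. i \<in> I \<Longrightarrow> j \<in> J \<Longrightarrow> a j i \<in> K"
  shows "\<exists>c. (\<forall>j\<in>J. c j \<in> K) \<and> (\<exists>j\<in>J. c j \<noteq> 0) \<and> (\<forall>i\<in>I. (\<Sum>j\<in>J. c j * a j i) = 0)"
  using assms(2-)
proof (induction I arbitrary: J a rule: finite_induct)
  case empty
  then have "J \<noteq> {}" by auto
  then show ?case using is_subfieldD(3)[OF K] by (intro exI[of _ "\<lambda>_. 1"]) auto
next
  case (insert i0 I)
  show ?case
  proof (cases "\<forall>j\<in>J. a j i0 = 0")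
    case True
    obtain c where "\<forall>j\<in>J. c j \<in> K" "\<exists>j\<in>J. c j \<noteq> 0" "\<forall>i\<in>I. (\<Sum>j\<in>J. c j * a j i) = 0"
      using insert.IH[of J a] insert.prems insert.hyps by auto
    then show ?thesis using True by (intro exI[of _ c]) auto
  next
    case False
    \<comment> \<open>\<open>j0\<close> is a pivot: equation \<open>i0\<close> determines this
      unknown from the others. \<open>a'\<close> is the system left after eliminating it, and
      \<open>e\<close> restores its value.\<close>
    then obtain j0 where j0: "j0 \<in> J" "a j0 i0 \<noteq> 0" by auto
    define J' where "J' = J - {j0}"
    have J': "finite J'" "J = insert j0 J'" "j0 \<notin> J'"
      using insert.prems j0 by (auto simp: J'_def)
    define a' where "a' j i = a j i - a j i0 / a j0 i0 * a j0 i" for j i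
    have "card I < card J'" using insert.prems insert.hyps J' by simp
    moreover have "a' j i \<in> K" if "i \<in> I" "j \<in> J'" for i j
      unfolding a'_def using that J' insert.prems(3)
      by (intro is_subfieldD(8,9,5)[OF K]) auto
    ultimately obtain c where c: "\<forall>j\<in>J'. c j \<in> K" "\<exists>j\<in>J'. c j \<noteq> 0"
      "\<forall>i\<in>I. (\<Sum>j\<in>J'. c j * a' j i) = 0"
      using insert.IH[of J' a'] J'(1) by auto
    define t where "t = (\<Sum>j\<in>J'. c j * a j i0)"
    define e where "e = c(j0 := - t / a j0 i0)"
    have "t \<in> K" unfolding t_def using J' insert.prems(3) c(1)
      by (intro is_subring_sum is_subfieldD(1,5)[OF K]) auto
    then have "e j0 \<in> K" unfolding e_def using j0 insert.prems(3)
      by (auto intro!: is_subfieldD(6,9)[OF K])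
    have e_eq: "e j = c j" if "j \<in> J'" for j using that J' by (auto simp: e_def)
    have sum_e: "(\<Sum>j\<in>J. e j * a j i) = - t / a j0 i0 * a j0 i + (\<Sum>j\<in>J'. c j * a j i)" for i
      using J' by (simp add: e_def cong: sum.cong) (auto intro!: sum.cong)
    have e2: "(\<Sum>j\<in>J. e j * a j i0) = 0"
      unfolding sum_e using j0 by (simp add: t_def)
    have e3: "(\<Sum>j\<in>J. e j * a j i) = 0" if "i \<in> I" for i
    proof -
      have "(\<Sum>j\<in>J'. c j * a' j i) = (\<Sum>j\<in>J'. c j * a j i - c j * a j i0 * (a j0 i / a j0 i0))"
        by (auto simp: a'_def algebra_simps intro!: sum.cong)
      also have "\<dots> = (\<Sum>j\<in>J'. c j * a j i) - t * (a j0 i / a j0 i0)"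
        by (simp only: sum_subtractf t_def sum_distrib_right)
      finally have "(\<Sum>j\<in>J'. c j * a j i) = t * (a j0 i / a j0 i0)" using c(3) that by simp
      then show ?thesis unfolding sum_e by simp
    qed
    have "\<forall>j\<in>J. e j \<in> K" using \<open>e j0 \<in> K\<close> c(1) e_eq unfolding J'(2) by simp
    moreover have "\<exists>j\<in>J. e j \<noteq> 0" using c(2) e_eq unfolding J'(2) by auto
    moreover have "\<forall>i\<in>insert i0 I. (\<Sum>j\<in>J. e j * a j i) = 0" using e2 e3 by blast
    ultimately show ?thesis by blast
  qed
qed

text \<open>Generated one summand at a time, with repeated generators allowed, so that closure
  properties are rule inductions; \<open>kspan_finiteE\<close> recovers one coefficient per
  generator.\<close>

inductive_set kspan :: "'a::field set \<Rightarrow> 'a set \<Rightarrow> 'a set" for K B where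
  zero: "0 \<in> kspan K B"
| step: "k \<in> K \<Longrightarrow> b \<in> B \<Longrightarrow> x \<in> kspan K B \<Longrightarrow> k * b + x \<in> kspan K B"

lemma kspan_base: "k \<in> K \<Longrightarrow> b \<in> B \<Longrightarrow> k * b \<in> kspan K B"
  using kspan.step[OF _ _ kspan.zero] by fastforce

lemma kspan_add: "x \<in> kspan K B \<Longrightarrow> y \<in> kspan K B \<Longrightarrow> x + y \<in> kspan K B"
  by (induction rule: kspan.induct) (auto simp: add.assoc intro: kspan.intros)

lemma kspan_mult:
  assumes "is_subring L" "l \<in> L" "x \<in> kspan L B"
  shows "l * x \<in> kspan L B"
  using assms(3)
  by (induction rule: kspan.induct)
     (auto simp: distrib_left mult.assoc[symmetric] intro!: kspan.intros is_subringD[OF assms(1)] assms(2))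

text \<open>The finiteness part of the tower law: expand each coefficient over \<open>B\<close> and
  multiply out.\<close>

lemma kspan_tower:
  assumes "L \<subseteq> kspan K B" "x \<in> kspan L B'"
  shows "x \<in> kspan K ((\<lambda>(b, b'). b * b') ` (B \<times> B'))"
  using assms(2)
proof (induction rule: kspan.induct)
  case (step l b' x)
  have "l * b' \<in> kspan K ((\<lambda>(b, b'). b * b') ` (B \<times> B'))" if "l \<in> kspan K B" for l
    using that step.hyps(2)
    by (induction rule: kspan.induct)
       (auto simp: distrib_right mult.assoc intro!: kspan.intros)
  then show ?case using step assms(1) by (intro kspan_add) auto
qed (rule kspan.zero)

lemma kspan_finiteE:
  assumes "is_subfield K" "finite B" "x \<in> kspan K B"
  obtains k where "\<And>b. k b \<in> K" "x = (\<Sum>b\<in>B. k b * b)"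
  using assms(3)
proof (induction arbitrary: thesis rule: kspan.induct)
  case zero
  show ?case using zero[of "\<lambda>_. 0"] is_subfieldD(2)[OF assms(1)] by simp
next
  case (step k b x)
  obtain k' where k': "\<And>b. k' b \<in> K" "x = (\<Sum>b\<in>B. k' b * b)" using step.IH by blast
  define f where "f = k'(b := k + k' b)"
  have "(\<Sum>c\<in>B. f c * c) = (\<Sum>c\<in>B. (if c = b then k * c else 0) + k' c * c)"
    by (intro sum.cong) (auto simp: f_def algebra_simps)
  also have "\<dots> = k * b + x"
    using step.hyps assms(2) by (simp add: sum.distrib k'(2))
  finally show ?case
    using step.prems[of f] step.hyps k'(1) is_subfieldD(4)[OF assms(1)] by (auto simp: f_def)
qed

lemma kspan_powers_imp_acl:
  assumes K: "is_subfield K" and B: "finite B" and x: "\<And>n. x ^ n \<in> kspan K B"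
  shows "x \<in> acl K"
proof -
  have "\<forall>n. \<exists>k. (\<forall>b. k b \<in> K) \<and> x ^ n = (\<Sum>b\<in>B. k b * b)"
    using kspan_finiteE[OF K B x] by metis
  then obtain k where k: "\<And>n b. k n b \<in> K" "\<And>n. x ^ n = (\<Sum>b\<in>B. k n b * b)" by metis
  \<comment> \<open>The exponents from 0 to \<open>card B\<close> are one more than the generators,
    so there are more unknowns than equations.\<close>
  obtain c where c: "\<forall>j\<in>{..card B}. c j \<in> K" "\<exists>j\<in>{..card B}. c j \<noteq> 0"
    "\<forall>b\<in>B. (\<Sum>j\<in>{..card B}. c j * k j b) = 0"
    using underdetermined_system[OF K B, of "{..card B}" k] k(1) by auto
  define p where "p = (\<Sum>j\<le>card B. monom (c j) j)"
  have cp: "coeff p n = (if n \<le> card B then c n else 0)" for n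
    by (simp add: p_def coeff_sum)
  have "poly p x = (\<Sum>j\<le>card B. c j * x ^ j)"
    by (simp add: p_def poly_sum poly_monom)
  also have "\<dots> = (\<Sum>j\<le>card B. \<Sum>b\<in>B. c j * k j b * b)"
    by (simp add: k(2) sum_distrib_left mult.assoc)
  also have "\<dots> = (\<Sum>b\<in>B. (\<Sum>j\<le>card B. c j * k j b) * b)"
    by (subst sum.swap) (simp add: sum_distrib_right)
  also have "\<dots> = 0" using c(3) by simp
  finally have "poly p x = 0" .
  moreover have "p \<in> polys K" using c(1) is_subfieldD(2)[OF K] by (auto simp: polys_def cp)
  moreover have "p \<noteq> 0" using c(2) cp by (metis atMost_iff coeff_0)
  ultimately show ?thesis by (auto simp: acl_def)
qed

text \<open>Being monic, \<open>p\<close> rewrites \<open>x ^ n\<close> in lower powers without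
  division, so the powers below \<open>n\<close> generate L[x] over the ring
  \<open>L\<close>.\<close>

lemma adjoin_integral:
  assumes L: "is_subring L" and p: "p \<in> polys L" "lead_coeff p = 1" "poly p x = 0"
    and L_neg: "\<And>l. l \<in> L \<Longrightarrow> - l \<in> L"
  shows "\<exists>B. finite B \<and> {poly q x |q. q \<in> polys L} \<subseteq> kspan L B"
proof -
  define n where "n = degree p"
  define B where "B = (\<lambda>i. x ^ i) ` {..<n}"
  \<comment> \<open>A monic constant has no root; \<open>n > 0\<close> also puts
    \<open>x ^ 0\<close> among the generators.\<close>
  have "n \<noteq> 0"
  proof
    assume "n = 0"
    then have "p = [:1:]" using p(2) degree_eq_zeroE[of p] unfolding n_def by fastforce
    then show False using p(3) by simp
  qed
  have span: "(\<Sum>i\<in>I. k i * x ^ i) \<in> kspan L B" if "I \<subseteq> {..<n}" "\<And>i. k i \<in> L" for I k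
    using finite_subset[OF that(1) finite_lessThan] that
    by (induction I rule: finite_induct) (auto simp: B_def intro!: kspan.zero kspan_add kspan_base)
  have "0 = (\<Sum>i\<le>n. coeff p i * x ^ i)" using p(3) by (simp add: poly_altdef n_def)
  also have "\<dots> = (\<Sum>i<n. coeff p i * x ^ i) + x ^ n"
    using p(2) by (simp add: lessThan_Suc_atMost[symmetric] n_def)
  finally have "x ^ n = (\<Sum>i<n. (- coeff p i) * x ^ i)"
    by (simp add: sum_negf eq_neg_iff_add_eq_0 add.commute)
  moreover have "- coeff p i \<in> L" for i using p(1) L_neg by (auto simp: polys_def)
  ultimately have xn: "x ^ n \<in> kspan L B" using span[of "{..<n}" "\<lambda>i. - coeff p i"] by simp
  have x_closed: "x * y \<in> kspan L B" if "y \<in> kspan L B" for y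
    using that
  proof (induction rule: kspan.induct)
    case (step k b y)
    obtain i where i: "i < n" "b = x ^ i" using step.hyps(2) by (auto simp: B_def)
    have "x ^ Suc i \<in> kspan L B"
    proof (cases "Suc i = n")
      case True
      then show ?thesis using xn by simp
    next
      case False
      then have "1 * x ^ Suc i \<in> kspan L B"
        using i by (intro kspan_base is_subringD[OF L]) (auto simp: B_def simp del: power_Suc)
      then show ?thesis by simp
    qed
    then have "k * (x * b) \<in> kspan L B"
      using kspan_mult[OF L step.hyps(1), of "x ^ Suc i" B] i by simp
    then have "k * (x * b) + x * y \<in> kspan L B" using step.IH by (rule kspan_add)
    then show ?case by (simp add: algebra_simps)
  qed (simp add: kspan.zero)
  have "poly q x \<in> kspan L B" if "q \<in> polys L" for q
    using that
  proof (induction q)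
    case (pCons a q)
    have "a * x ^ 0 \<in> kspan L B"
      using pCons.prems \<open>n \<noteq> 0\<close> unfolding B_def
      by (intro kspan_base imageI) (auto simp: polys_pCons)
    then have "a * x ^ 0 + x * poly q x \<in> kspan L B"
      using pCons by (intro kspan_add x_closed) (auto simp: polys_pCons)
    then show ?case by simp
  qed (simp add: kspan.zero)
  then show ?thesis by (intro exI[of _ B]) (auto simp: B_def)
qed

text \<open>A ring extension of \<open>K\<close> that is finite as a module. Negation is a separate
  clause because \<open>is_subring\<close> does not include it, while rewriting by a monic
  polynomial changes signs.\<close>

definition finite_subring :: "'a::field set \<Rightarrow> 'a set \<Rightarrow> bool" where
  "finite_subring K L \<longleftrightarrow> is_subring L \<and> K \<subseteq> L \<and> (\<forall>x\<in>L. - x \<in> L) \<and> (\<exists>B. finite B \<and> L \<subseteq> kspan K B)"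

lemma finite_subring_adjoin:
  assumes L: "finite_subring K L" and p: "p \<in> polys L" "lead_coeff p = 1" "poly p x = 0"
  shows "\<exists>L'. finite_subring K L' \<and> L \<subseteq> L' \<and> x \<in> L'"
proof -
  have L': "is_subring L" "\<And>x. x \<in> L \<Longrightarrow> - x \<in> L" using L by (auto simp: finite_subring_def)
  define M where "M = {poly q x |q. q \<in> polys L}"
  obtain B where B: "finite B" "L \<subseteq> kspan K B" using L by (auto simp: finite_subring_def)
  obtain B' where B': "finite B'" "M \<subseteq> kspan L B'"
    using adjoin_integral[OF L'(1) p L'(2)] unfolding M_def by blast
  have "M \<subseteq> kspan K ((\<lambda>(b, b'). b * b') ` (B \<times> B'))"
    using kspan_tower[OF B(2)] B'(2) by blast
  moreover have "L \<subseteq> M"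
  proof
    fix l assume "l \<in> L"
    then show "l \<in> M" unfolding M_def using polys_const[OF L'(1)]
      by (intro CollectI exI[of _ "[:l:]"]) auto
  qed
  moreover have "is_subring M"
    unfolding is_subring_def
  proof (intro conjI ballI)
    show "0 \<in> M" "1 \<in> M" using \<open>L \<subseteq> M\<close> is_subringD[OF L'(1)] by auto
    fix a b assume "a \<in> M" "b \<in> M"
    then obtain q r where q: "a = poly q x" "q \<in> polys L" and r: "b = poly r x" "r \<in> polys L"
      by (auto simp: M_def)
    have "poly (q + r) x \<in> M" "poly (q * r) x \<in> M" unfolding M_def
      using polys_add[OF L'(1) q(2) r(2)] polys_mult[OF L'(1) q(2) r(2)] by blast+
    then show "a + b \<in> M" "a * b \<in> M" by (simp_all add: q r)
  qed
  moreover have "- a \<in> M" if a: "a \<in> M" for a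
  proof -
    obtain q where "a = poly q x" "q \<in> polys L" using a by (auto simp: M_def)
    moreover from this have "- q \<in> polys L" using L'(2) by (auto simp: polys_def)
    ultimately show ?thesis unfolding M_def by (intro CollectI exI[of _ "- q"]) auto
  qed
  moreover have "x \<in> M"
    unfolding M_def using is_subringD[OF L'(1)]
    by (intro CollectI exI[of _ "[:0, 1:]"]) (auto simp: polys_pCons polys_0)
  moreover have "finite ((\<lambda>(b, b'). b * b') ` (B \<times> B'))" using B B' by simp
  ultimately have "finite_subring K M" "L \<subseteq> M" "x \<in> M"
    using L unfolding finite_subring_def by blast+
  then show ?thesis by blast
qed

lemma finite_subring_subset_acl:
  assumes "is_subfield K" "finite_subring K L"
  shows "L \<subseteq> acl K"
proof
  fix x assume "x \<in> L"
  obtain B where B: "finite B" "L \<subseteq> kspan K B" and L: "is_subring L"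
    using assms(2) by (auto simp: finite_subring_def)
  show "x \<in> acl K"
    using is_subring_power[OF L \<open>x \<in> L\<close>] B by (intro kspan_powers_imp_acl[OF assms(1) B(1)]) auto
qed

lemma monic_witness:
  assumes "is_subfield K" "x \<in> acl K"
  obtains p where "p \<in> polys K" "lead_coeff p = 1" "poly p x = 0"
proof -
  obtain p where p: "p \<in> polys K" "p \<noteq> 0" "poly p x = 0" using assms(2) by (auto simp: acl_def)
  have "inverse (lead_coeff p) \<in> K"
    using p(1) is_subfieldD(7)[OF assms(1)] by (auto simp: polys_def)
  then show ?thesis
    using p by (intro that[of "smult (inverse (lead_coeff p)) p"] polys_smult is_subfieldD(1)[OF assms(1)]) auto
qed

lemma finite_subring_containing:
  assumes K: "is_subfield K" and "finite S" "S \<subseteq> acl K"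
  shows "\<exists>L. finite_subring K L \<and> S \<subseteq> L"
  using assms(2,3)
proof (induction rule: finite_induct)
  case empty
  have "K \<subseteq> kspan K {1}" using kspan_base[of _ K 1 "{1}"] by force
  then have "finite_subring K K"
    unfolding finite_subring_def using is_subfieldD(1,6)[OF K] by blast
  then show ?case by blast
next
  case (insert x S)
  then obtain L where L: "finite_subring K L" "S \<subseteq> L" by auto
  have "x \<in> acl K" using insert.prems by simp
  then obtain p where p: "p \<in> polys K" "lead_coeff p = 1" "poly p x = 0"
    using monic_witness[OF K] by blast
  have "K \<subseteq> L" using L(1) by (simp add: finite_subring_def)
  then show ?case
    using finite_subring_adjoin[OF L(1) _ p(2,3)] p(1) polys_mono L(2) by blast
qed

text \<open>Two algebraic elements lie in a common finite ring over \<open>K\<close>, all of whose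
  elements are algebraic; no polynomial for a sum or a product has to be constructed. The inverse is
  a root of the reversed polynomial.\<close>

lemma is_subfield_acl:
  assumes K: "is_subfield K"
  shows "is_subfield (acl K)"
  unfolding is_subfield_def is_subring_def
proof (intro conjI ballI)
  show "0 \<in> acl K" "1 \<in> acl K" using subset_acl[OF K] is_subfieldD[OF K] by auto
next
  fix x y assume "x \<in> acl K" "y \<in> acl K"
  then obtain L where L: "finite_subring K L" "x \<in> L" "y \<in> L"
    using finite_subring_containing[OF K, of "{x, y}"] by auto
  have "is_subring L" using L(1) by (simp add: finite_subring_def)
  then have "x + y \<in> L" "x * y \<in> L"
    using L(2,3) by (auto intro: is_subringD)
  then show "x + y \<in> acl K" "x * y \<in> acl K"
    using finite_subring_subset_acl[OF K L(1)] by auto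
next
  fix x assume x: "x \<in> acl K"
  then obtain L where L: "finite_subring K L" "x \<in> L"
    using finite_subring_containing[OF K, of "{x}"] by auto
  then show "- x \<in> acl K"
    using finite_subring_subset_acl[OF K L(1)] by (auto simp: finite_subring_def)
  show "inverse x \<in> acl K"
  proof (cases "x = 0")
    case False
    obtain p where p: "p \<in> polys K" "p \<noteq> 0" "poly p x = 0" using x by (auto simp: acl_def)
    have "reflect_poly p \<in> polys K"
      using p(1) is_subfieldD(2)[OF K] by (auto simp: polys_def coeff_reflect_poly)
    moreover have "poly (reflect_poly p) (inverse x) = 0"
      using p(3) False by (simp add: poly_reflect_poly_nz)
    moreover have "reflect_poly p \<noteq> 0"
      using p(2) by (simp add: reflect_poly_eq_0_iff)
    ultimately show ?thesis unfolding acl_def by blast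
  qed (use x in simp)
qed

text \<open>The finitely many coefficients of a monic equation over \<open>acl K\<close> lie in a
  finite ring over \<open>K\<close>, and adjoining its root keeps the ring finite.\<close>

lemma acl_idem:
  assumes K: "is_subfield K"
  shows "acl (acl K) = acl K"
proof
  show "acl K \<subseteq> acl (acl K)" by (intro subset_acl is_subfield_acl K)
  show "acl (acl K) \<subseteq> acl K"
  proof
    fix x assume "x \<in> acl (acl K)"
    then obtain p where p: "p \<in> polys (acl K)" "lead_coeff p = 1" "poly p x = 0"
      using monic_witness[OF is_subfield_acl[OF K]] by blast
    have "coeff p ` {..degree p} \<subseteq> acl K" using p(1) by (auto simp: polys_def)
    then obtain L where L: "finite_subring K L" "coeff p ` {..degree p} \<subseteq> L"
      using finite_subring_containing[OF K, of "coeff p ` {..degree p}"] by auto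
    have "coeff p i \<in> L" for i
    proof (cases "i \<le> degree p")
      case True
      then show ?thesis using L(2) by blast
    next
      case False
      then show ?thesis using L(1) is_subringD(1) by (auto simp: coeff_eq_0 finite_subring_def)
    qed
    then have "p \<in> polys L" by (simp add: polys_def)
    then obtain L' where "finite_subring K L'" "x \<in> L'"
      using finite_subring_adjoin[OF L(1) _ p(2,3)] by blast
    then show "x \<in> acl K" using finite_subring_subset_acl[OF K] by blast
  qed
qed

section \<open>Simple transcendental extensions\<close>

text \<open>The field K(t) inside the ambient field. A vanishing denominator does no harm, since
  division by zero gives 0; \<open>ratfE\<close> always supplies a nonzero one.\<close>

definition ratf :: "'a::field set \<Rightarrow> 'a \<Rightarrow> 'a set" where
  "ratf K t = {poly p t / poly q t |p q. p \<in> polys K \<and> q \<in> polys K}"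

lemma ratfI: "p \<in> polys K \<Longrightarrow> q \<in> polys K \<Longrightarrow> poly p t / poly q t \<in> ratf K t"
  by (auto simp: ratf_def)

lemma ratfE:
  assumes K: "is_subfield K" and x: "x \<in> ratf K t"
  obtains p q where "p \<in> polys K" "q \<in> polys K" "poly q t \<noteq> 0" "x = poly p t / poly q t"
proof -
  obtain p q where pq: "p \<in> polys K" "q \<in> polys K" "x = poly p t / poly q t"
    using x by (auto simp: ratf_def)
  show ?thesis
  proof (cases "poly q t = 0")
    case True
    then have "x = poly 0 t / poly 1 t" using pq by simp
    then show ?thesis using is_subfieldD[OF K]
      by (intro that[of 0 1]) (auto intro: polys_0 polys_1)
  qed (use pq that in blast)
qed

lemma ratf_poly:
  assumes "is_subfield K" "p \<in> polys K"
  shows "poly p t \<in> ratf K t"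
  using ratfI[OF assms(2) polys_1, of t] is_subfieldD(1)[OF assms(1)] by simp

lemma subset_ratf:
  assumes K: "is_subfield K"
  shows "K \<subseteq> ratf K t"
proof
  fix k assume "k \<in> K"
  then show "k \<in> ratf K t"
    using ratf_poly[OF K polys_const, of k t] is_subfieldD(1)[OF K] by simp
qed

lemma generator_in_ratf:
  assumes K: "is_subfield K"
  shows "t \<in> ratf K t"
  using ratf_poly[OF K, of "[:0, 1:]" t] is_subfieldD[OF K] by (simp add: polys_pCons polys_0)

lemma is_subfield_ratf:
  assumes K: "is_subfield K"
  shows "is_subfield (ratf K t)"
  unfolding is_subfield_def is_subring_def
proof (intro conjI ballI)
  note R = is_subfieldD(1)[OF K]
  show "0 \<in> ratf K t" "1 \<in> ratf K t" using subset_ratf[OF K] is_subfieldD[OF K] by auto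
  fix x assume x: "x \<in> ratf K t"
  then obtain p q where p: "p \<in> polys K" "q \<in> polys K" "poly q t \<noteq> 0" "x = poly p t / poly q t"
    by (rule ratfE[OF K])
  have "- x = poly (- p) t / poly q t" "inverse x = poly q t / poly p t" by (simp_all add: p)
  then show "- x \<in> ratf K t" "inverse x \<in> ratf K t"
    using p polys_uminus[OF K] by (metis ratfI)+
  fix y assume "y \<in> ratf K t"
  then obtain p' q' where p': "p' \<in> polys K" "q' \<in> polys K" "poly q' t \<noteq> 0"
    "y = poly p' t / poly q' t" by (rule ratfE[OF K])
  have "x + y = poly (p * q' + p' * q) t / poly (q * q') t"
    "x * y = poly (p * p') t / poly (q * q') t"
    using p(3) p'(3) unfolding p(4) p'(4) by (simp_all add: add_frac_eq)
  moreover have "p * q' + p' * q \<in> polys K" "p * p' \<in> polys K" "q * q' \<in> polys K"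
    using p p' by (auto intro!: polys_add polys_mult R)
  ultimately show "x + y \<in> ratf K t" "x * y \<in> ratf K t" by (metis ratfI)+
qed

lemma ratf_common_denominator:
  assumes K: "is_subfield K" and "finite I" and "\<And>i. i \<in> I \<Longrightarrow> f i \<in> ratf K t"
  shows "\<exists>g q. q \<in> polys K \<and> poly q t \<noteq> 0 \<and> (\<forall>i\<in>I. g i \<in> polys K \<and> f i = poly (g i) t / poly q t)"
  using assms(2,3)
proof (induction I rule: finite_induct)
  case empty
  have "1 \<in> polys K" "poly 1 t \<noteq> 0" using polys_1 is_subfieldD(1)[OF K] by auto
  then show ?case by blast
next
  case (insert i I)
  note R = is_subfieldD(1)[OF K]
  obtain g q where g: "q \<in> polys K" "poly q t \<noteq> 0"
    "\<forall>i\<in>I. g i \<in> polys K \<and> f i = poly (g i) t / poly q t"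
    using insert.IH insert.prems by auto
  obtain p r where p: "p \<in> polys K" "r \<in> polys K" "poly r t \<noteq> 0" "f i = poly p t / poly r t"
    using ratfE[OF K insert.prems[of i]] by auto
  define h where "h j = (if j = i then p * q else g j * r)" for j
  have "h j \<in> polys K \<and> f j = poly (h j) t / poly (q * r) t" if "j \<in> insert i I" for j
    using that insert.hyps g p by (auto simp: h_def intro!: polys_mult R)
  moreover have "q * r \<in> polys K" "poly (q * r) t \<noteq> 0"
    using g p by (auto intro: polys_mult R)
  ultimately show ?case by blast
qed

text \<open>A bivariate polynomial relation between \<open>s\<close> and \<open>t\<close> is read as an equation for \<open>t\<close>.\<close>

lemma acl_exchange:
  assumes K: "is_subfield K" and s: "s \<in> acl (ratf K t)" "s \<notin> acl K"
  shows "t \<in> acl (ratf K s)"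
proof -
  note R = is_subfieldD(1)[OF K]
  obtain p where p: "p \<in> polys (ratf K t)" "p \<noteq> 0" "poly p s = 0" using s(1) by (auto simp: acl_def)
  define n where "n = degree p"
  obtain g q where g: "q \<in> polys K" "poly q t \<noteq> 0"
    "\<forall>i\<in>{..n}. g i \<in> polys K \<and> coeff p i = poly (g i) t / poly q t"
    using ratf_common_denominator[OF K, of "{..n}" "coeff p" t] p(1) by (auto simp: polys_def)
  define m where "m = Max ((\<lambda>i. degree (g i)) ` {..n})"
  have m: "degree (g i) \<le> m" if "i \<le> n" for i using that by (auto simp: m_def)
  \<comment> \<open>The cleared relation is sorted by powers of \<open>t\<close>: \<open>c j\<close>
    is the polynomial whose value at \<open>s\<close> multiplies \<open>t ^ j\<close>.\<close>
  define c where "c j = (\<Sum>i\<le>n. monom (coeff (g i) j) i)" for j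
  have coeff_c: "coeff (c j) i = (if i \<le> n then coeff (g i) j else 0)" for i j
    by (simp add: c_def coeff_sum)
  have c: "c j \<in> polys K" for j
    using g(3) is_subfieldD(2)[OF K] by (auto simp: polys_def coeff_c)
  define P where "P = (\<Sum>j\<le>m. monom (poly (c j) s) j)"
  have coeff_P: "coeff P j = (if j \<le> m then poly (c j) s else 0)" for j
    by (simp add: P_def coeff_sum)
  have "P \<in> polys (ratf K s)"
    using ratf_poly[OF K c] subset_ratf[OF K] is_subfieldD(2)[OF K] by (auto simp: polys_def coeff_P)
  moreover have "poly P t = 0"
  proof -
    have poly_g: "poly (g i) t = (\<Sum>j\<le>m. coeff (g i) j * t ^ j)" if "i \<le> n" for i
      unfolding poly_altdef using m[OF that]
      by (intro sum.mono_neutral_left) (auto simp: coeff_eq_0)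
    have "poly P t = (\<Sum>j\<le>m. \<Sum>i\<le>n. coeff (g i) j * s ^ i * t ^ j)"
      by (simp add: P_def poly_sum poly_monom c_def sum_distrib_right)
    also have "\<dots> = (\<Sum>i\<le>n. poly (g i) t * s ^ i)"
      by (subst sum.swap) (auto simp: poly_g sum_distrib_left mult_ac intro!: sum.cong)
    also have "\<dots> = poly q t * (\<Sum>i\<le>n. coeff p i * s ^ i)"
      using g by (auto simp: sum_distrib_left intro!: sum.cong)
    also have "\<dots> = 0" using p(3) by (simp add: poly_altdef n_def)
    finally show ?thesis .
  qed
  moreover have "P \<noteq> 0"
  proof -
    have "coeff p n \<noteq> 0" using p(2) by (simp add: n_def)
    then have "g n \<noteq> 0" using g(3) by auto
    then obtain j where j: "coeff (g n) j \<noteq> 0" by (metis coeff_0 poly_eqI)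
    then have "j \<le> m" using m[of n] le_degree[of "g n" j] by simp
    have "c j \<noteq> 0" using j coeff_c[of j n] by auto
    \<comment> \<open>Transcendence of \<open>s\<close> over \<open>K\<close> keeps a nonzero
      polynomial from vanishing at \<open>s\<close>.\<close>
    then have "poly (c j) s \<noteq> 0" using s(2) c by (auto simp: acl_def)
    then show ?thesis using coeff_P[of j] \<open>j \<le> m\<close> by auto
  qed
  ultimately show ?thesis by (auto simp: acl_def)
qed

section \<open>Derivations\<close>

lemma min_poly:
  assumes K: "is_subfield K" and x: "x \<in> acl K"
  obtains p where "p \<in> polys K" "lead_coeff p = 1" "poly p x = 0" "degree p > 0"
    "\<And>q. q \<in> polys K \<Longrightarrow> poly q x = 0 \<Longrightarrow> degree q < degree p \<Longrightarrow> q = 0"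
proof -
  define P where "P p \<longleftrightarrow> p \<in> polys K \<and> lead_coeff p = 1 \<and> poly p x = 0" for p
  obtain p0 where "P p0" using monic_witness[OF K x] unfolding P_def by metis
  then obtain p where p: "P p" and min: "\<And>q. P q \<Longrightarrow> degree p \<le> degree q"
    using ex_has_least_nat[of P p0 degree] by blast
  show ?thesis
  proof (rule that[of p])
    show "p \<in> polys K" "lead_coeff p = 1" "poly p x = 0" using p by (auto simp: P_def)
    show "degree p > 0"
    proof (rule ccontr)
      assume "\<not> degree p > 0"
      then obtain a where "p = [:a:]" by (metis degree_eq_zeroE gr0I)
      then show False using p by (auto simp: P_def)
    qed
    fix q assume q: "q \<in> polys K" "poly q x = 0" "degree q < degree p"
    show "q = 0"
    proof (rule ccontr)
      assume "q \<noteq> 0"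
      have "inverse (lead_coeff q) \<in> K" using q(1) is_subfieldD(7)[OF K] by (auto simp: polys_def)
      then have "P (smult (inverse (lead_coeff q)) q)"
        unfolding P_def using q \<open>q \<noteq> 0\<close> by (auto intro!: polys_smult is_subfieldD(1)[OF K])
      from min[OF this] q(3) \<open>q \<noteq> 0\<close> show False by simp
    qed
  qed
qed

section \<open>Derivations of a field and their coefficientwise action on polynomials\<close>

locale derivation =
  fixes D :: "'a::field_char_0 \<Rightarrow> 'a"
  assumes D_add: "D (x + y) = D x + D y"
    and D_mult: "D (x * y) = D x * y + x * D y"
begin

lemma D_0 [simp]: "D 0 = 0"
  using D_add[of 0 0] by simp

lemma D_1 [simp]: "D 1 = 0"
  using D_mult[of 1 1] by simp

lemma D_uminus: "D (- x) = - D x"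
  using D_add[of x "- x"] by (simp add: eq_neg_iff_add_eq_0 add.commute)

lemma D_diff: "D (x - y) = D x - D y"
  using D_add[of x "- y"] by (simp add: D_uminus)

lemma D_of_nat [simp]: "D (of_nat n) = 0"
  by (induction n) (simp_all add: D_add)

lemma D_power: "D (x ^ n) = of_nat n * x ^ (n - 1) * D x"
proof (induction n)
  case (Suc n)
  then show ?case by (cases n) (simp_all add: D_mult algebra_simps)
qed simp

lemma D_divide:
  assumes "y \<noteq> 0"
  shows "D (x / y) = (D x * y - x * D y) / y\<^sup>2"
proof -
  have "D x = D (x / y) * y + x / y * D y"
    using D_mult[of "x / y" y] assms by simp
  then show ?thesis using assms by (simp add: field_simps power2_eq_square)
qed

lemma D_inverse: "D (inverse x) = - D x / x\<^sup>2"
  by (cases "x = 0") (simp_all add: inverse_eq_divide D_divide)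

abbreviation Dp :: "'a poly \<Rightarrow> 'a poly" where
  "Dp \<equiv> map_poly D"

lemma coeff_Dp [simp]: "coeff (Dp p) i = D (coeff p i)"
  by (simp add: coeff_map_poly)

lemma Dp_pCons: "Dp (pCons a p) = pCons (D a) (Dp p)"
  by (rule poly_eqI) (simp add: coeff_pCons split: nat.splits)

lemma Dp_add: "Dp (p + q) = Dp p + Dp q"
  by (rule poly_eqI) (simp add: D_add)

lemma Dp_diff: "Dp (p - q) = Dp p - Dp q"
  by (rule poly_eqI) (simp add: D_diff)

lemma Dp_smult: "Dp (smult a p) = smult (D a) p + smult a (Dp p)"
  by (rule poly_eqI) (simp add: D_mult)

lemma Dp_mult: "Dp (p * q) = Dp p * q + p * Dp q"
proof (induction p)
  case (pCons a p)
  have "Dp (pCons a p * q) = Dp (smult a q) + Dp (pCons 0 (p * q))"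
    by (simp add: Dp_add)
  also have "\<dots> = Dp (pCons a p) * q + pCons a p * Dp q"
  proof -
    have "pCons 0 (Dp p * q + p * Dp q) = pCons 0 (Dp p * q) + pCons 0 (p * Dp q)" by simp
    then show ?thesis by (simp add: Dp_smult Dp_pCons pCons.IH del: add_pCons)
  qed
  finally show ?case .
qed simp

lemma pderiv_Dp: "pderiv (Dp p) = Dp (pderiv p)"
  by (rule poly_eqI) (simp add: coeff_pderiv D_mult del: of_nat_Suc)

lemma D_poly: "D (poly p x) = poly (Dp p) x + D x * poly (pderiv p) x"
  by (induction p) (simp_all add: D_add D_mult Dp_pCons pderiv_pCons algebra_simps)

section \<open>Constants and differential subfields\<close>

definition constants :: "'a set" where
  "constants = {x. D x = 0}"

definition dsubfield :: "'a set \<Rightarrow> bool" where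
  "dsubfield K \<longleftrightarrow> is_subfield K \<and> (\<forall>x\<in>K. D x \<in> K)"

text \<open>The shape of every stage of the tower. It contains all constants of the ambient field,
  so no stage creates new ones; it is relatively algebraically closed, so algebraic steps stay
  inside and every element outside is transcendental over it.\<close>

definition dclosed :: "'a set \<Rightarrow> bool" where
  "dclosed K \<longleftrightarrow> dsubfield K \<and> constants \<subseteq> K \<and> acl K \<subseteq> K"

lemma Dp_in_polys: "dsubfield K \<Longrightarrow> p \<in> polys K \<Longrightarrow> Dp p \<in> polys K"
  by (auto simp: dsubfield_def polys_def)

lemma is_subfield_constants: "is_subfield constants"
  by (auto simp: is_subfield_def is_subring_def constants_def D_add D_mult D_uminus D_inverse)

lemma Dp_constants: "p \<in> polys constants \<Longrightarrow> Dp p = 0"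
  by (rule poly_eqI) (auto simp: polys_def constants_def)

lemma dsubfield_ratf:
  assumes K: "dsubfield K" and t: "D t \<in> ratf K t"
  shows "dsubfield (ratf K t)"
proof -
  have K': "is_subfield K" using K by (simp add: dsubfield_def)
  note F = is_subfieldD[OF is_subfield_ratf[OF K', of t]]
  have D_poly_in: "D (poly p t) \<in> ratf K t" if "p \<in> polys K" for p
    unfolding D_poly
    by (intro F(4,5) t ratf_poly K' Dp_in_polys[OF K] polys_pderiv is_subfieldD(1) that)
  have "D x \<in> ratf K t" if x: "x \<in> ratf K t" for x
  proof -
    obtain p q where p: "p \<in> polys K" "q \<in> polys K" "poly q t \<noteq> 0" "x = poly p t / poly q t"
      by (rule ratfE[OF K' x])
    show ?thesis
      unfolding p(4) D_divide[OF p(3)] power2_eq_square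
      by (intro F(5,8,9) D_poly_in ratf_poly K' p(1,2))
  qed
  then show ?thesis using is_subfield_ratf[OF K'] by (simp add: dsubfield_def)
qed

text \<open>Differentiate \<open>p(x) = 0\<close> for a minimal \<open>p\<close>; in characteristic
  zero \<open>pderiv p\<close> is nonzero of smaller degree, so it cannot vanish at
  \<open>x\<close>.\<close>

lemma D_algebraic:
  assumes "is_subfield K" "x \<in> acl K"
  obtains p where "p \<in> polys K" "poly (pderiv p) x \<noteq> 0" "D x = - poly (Dp p) x / poly (pderiv p) x"
proof -
  obtain p where p: "p \<in> polys K" "poly p x = 0" "degree p > 0"
    and min: "\<And>q. q \<in> polys K \<Longrightarrow> poly q x = 0 \<Longrightarrow> degree q < degree p \<Longrightarrow> q = 0"
    using min_poly[OF assms] by metis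
  have "pderiv p \<noteq> 0" using p(3) by (simp add: pderiv_eq_0_iff)
  moreover have "pderiv p \<in> polys K" using p(1) by (intro polys_pderiv is_subfieldD(1) assms(1))
  moreover have "degree (pderiv p) < degree p" using p(3) by (simp add: degree_pderiv)
  ultimately have "poly (pderiv p) x \<noteq> 0" using min by blast
  moreover have "poly (Dp p) x + D x * poly (pderiv p) x = 0" using D_poly[of p x] p(2) by simp
  ultimately show ?thesis using p(1) by (intro that[of p]) (auto simp: field_simps eq_neg_iff_add_eq_0)
qed

lemma dsubfield_acl:
  assumes K: "dsubfield K"
  shows "dsubfield (acl K)"
proof -
  have K': "is_subfield K" using K by (simp add: dsubfield_def)
  note F = is_subfieldD[OF is_subfield_acl[OF K']]
  have "D x \<in> acl K" if x: "x \<in> acl K" for x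
  proof -
    obtain p where p: "p \<in> polys K" "D x = - poly (Dp p) x / poly (pderiv p) x"
      using D_algebraic[OF K' x] by metis
    have "Dp p \<in> polys (acl K)" "pderiv p \<in> polys (acl K)"
      using polys_mono[OF subset_acl[OF K']] Dp_in_polys[OF K p(1)]
        polys_pderiv[OF is_subfieldD(1)[OF K'] p(1)] by blast+
    then show ?thesis unfolding p(2) by (intro F(6,9) poly_in_subring F(1) x)
  qed
  then show ?thesis using is_subfield_acl[OF K'] by (simp add: dsubfield_def)
qed

lemma dclosed_acl:
  assumes "dsubfield K" "constants \<subseteq> K"
  shows "dclosed (acl K)"
  using assms dsubfield_acl[OF assms(1)] subset_acl[of K] acl_idem[of K]
  by (auto simp: dclosed_def dsubfield_def)

text \<open>The bottom of the tower. Coefficientwise derivation kills a polynomial over the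
  constants, so its simple roots have derivative 0.\<close>

lemma dclosed_constants: "dclosed constants"
proof -
  have "D x = 0" if x: "x \<in> acl constants" for x
  proof -
    obtain p where p: "p \<in> polys constants" "D x = - poly (Dp p) x / poly (pderiv p) x"
      using D_algebraic[OF is_subfield_constants x] by metis
    then show ?thesis by (simp add: Dp_constants)
  qed
  moreover have "dsubfield constants"
    using is_subfield_constants by (auto simp: dsubfield_def constants_def)
  ultimately show ?thesis by (auto simp: dclosed_def constants_def)
qed

text \<open>A coefficient of the minimal polynomial of \<open>\<theta>\<close> over \<open>F\<close> inherits from \<open>\<theta>\<close>
  the property of being a logarithm or an exponential over \<open>K\<close>.\<close>

lemma log_exp_element_descends:
  assumes K: "dclosed K" and F: "dsubfield F" "K \<subseteq> F"
    and th: "\<theta> \<in> acl F" "\<theta> \<notin> K" "D \<theta> \<in> K \<or> (\<exists>a\<in>K. D \<theta> = a * \<theta>)"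
  obtains q where "q \<in> F" "q \<notin> K" "D q \<in> K \<or> (\<exists>b\<in>K. D q = b * q)"
proof -
  have F': "is_subfield F" and K': "is_subfield K" and cK: "constants \<subseteq> K"
    using F K by (auto simp: dsubfield_def dclosed_def)
  obtain p where p: "p \<in> polys F" "lead_coeff p = 1" "poly p \<theta> = 0" "degree p > 0"
    and min: "\<And>q. q \<in> polys F \<Longrightarrow> poly q \<theta> = 0 \<Longrightarrow> degree q < degree p \<Longrightarrow> q = 0"
    using min_poly[OF F' th(1)] by metis
  define n where "n = degree p"
  have n: "n > 0" "coeff p n = 1" using p by (simp_all add: n_def)
  have n_nz: "(of_nat n :: 'a) \<noteq> 0" using n by simp
  have ofn: "of_nat n \<in> K" by (intro is_subring_of_nat is_subfieldD(1) K')
  have pF: "coeff p i \<in> F" for i using p(1) by (simp add: polys_def)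
  note R = is_subfieldD(1)[OF F']
  have deg_less: "degree r < n" if "\<And>i. i \<ge> n \<Longrightarrow> coeff r i = 0" for r :: "'a poly"
    using that n by (metis coeff_eq_0 degree_0 le_degree leading_coeff_0_iff not_le)
  from th(3) show ?thesis
  proof
    assume a: "D \<theta> \<in> K"
    \<comment> \<open>Differentiating \<open>p(\<theta>) = 0\<close> gives
      \<open>r(\<theta>) = 0\<close>. The leading coefficient 1 has derivative 0, so
      \<open>r\<close> has degree below \<open>n\<close> and is zero by minimality.\<close>
    define r where "r = Dp p + smult (D \<theta>) (pderiv p)"
    have "r \<in> polys F" unfolding r_def
      using a F(2) by (intro polys_add polys_smult R Dp_in_polys F p polys_pderiv) auto
    moreover have "poly r \<theta> = 0" using D_poly[of p \<theta>] p(3) by (simp add: r_def)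
    moreover have "coeff r i = 0" if "i \<ge> n" for i
    proof -
      have "coeff p (Suc i) = 0" using that by (simp add: n_def coeff_eq_0)
      moreover have "D (coeff p i) = 0"
        using that n by (cases "i = n") (simp_all add: n_def coeff_eq_0)
      ultimately show ?thesis by (simp add: r_def coeff_pderiv)
    qed
    ultimately have "r = 0" using min deg_less unfolding n_def by blast
    \<comment> \<open>Up to sign the sum of the roots of \<open>p\<close>; the coefficient of
      \<open>r\<close> at \<open>n - 1\<close> says that \<open>c + n \<theta>\<close> is a
      constant.\<close>
    define c where "c = coeff p (n - 1)"
    have "coeff r (n - 1) = 0" using \<open>r = 0\<close> by simp
    then have Dc: "D c + of_nat n * D \<theta> = 0"
      using n by (simp add: r_def coeff_pderiv c_def algebra_simps del: of_nat_Suc)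
    have "c \<notin> K"
    proof
      assume "c \<in> K"
      have "D (c + of_nat n * \<theta>) = 0" using Dc by (simp add: D_add D_mult)
      then have "c + of_nat n * \<theta> \<in> K" using cK by (auto simp: constants_def)
      then have "(c + of_nat n * \<theta> - c) / of_nat n \<in> K"
        using \<open>c \<in> K\<close> ofn by (intro is_subfieldD(8,9)[OF K'])
      then show False using th(2) n_nz by simp
    qed
    moreover have "D c = - (of_nat n * D \<theta>)" using Dc by (simp add: eq_neg_iff_add_eq_0)
    then have "D c \<in> K" using a ofn by (auto intro!: is_subfieldD(5,6)[OF K'])
    ultimately show ?thesis using that pF c_def by blast
  next
    assume "\<exists>a\<in>K. D \<theta> = a * \<theta>"
    then obtain a where a: "a \<in> K" "D \<theta> = a * \<theta>" by blast
    \<comment> \<open>Now \<open>D \<theta> = a \<theta>\<close> turns the second part of the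
      derivative into \<open>a X p'\<close>. Subtracting \<open>n a p\<close> cancels the
      coefficient at degree \<open>n\<close>, so minimality applies again.\<close>
    define r where "r = Dp p + smult a (pCons 0 (pderiv p)) - smult (of_nat n * a) p"
    have "r \<in> polys F" unfolding r_def
      using a(1) F(2) ofn p(1) is_subfieldD(2,5)[OF F']
      by (intro polys_diff polys_add polys_smult R F' Dp_in_polys F p) (auto simp: polys_pCons polys_pderiv[OF R])
    moreover have "poly r \<theta> = 0" using D_poly[of p \<theta>] p(3) a(2) by (simp add: r_def algebra_simps)
    moreover have "coeff r i = 0" if "i \<ge> n" for i
    proof (cases "i = n")
      case True
      then obtain k where k: "i = Suc k" using n by (cases i) auto
      have "coeff r i = D (coeff p i) + a * (of_nat (Suc k) * coeff p i) - of_nat n * a * coeff p i"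
        unfolding r_def k by (simp add: coeff_pderiv del: of_nat_Suc)
      then show ?thesis using True n k by (simp del: of_nat_Suc)
    next
      case False
      then obtain k where k: "i = Suc k" using \<open>i \<ge> n\<close> n by (cases i) auto
      show ?thesis using False \<open>i \<ge> n\<close> unfolding r_def
        by (simp add: k coeff_pderiv n_def coeff_eq_0 del: of_nat_Suc)
    qed
    ultimately have "r = 0" using min deg_less unfolding n_def by blast
    \<comment> \<open>Up to sign the product of the roots of \<open>p\<close>; it has the same
      logarithmic derivative as \<open>\<theta> ^ n\<close>, which makes
      \<open>\<theta> ^ n / c\<close> a constant.\<close>
    define c where "c = coeff p 0"
    have "coeff r 0 = 0" using \<open>r = 0\<close> by simp
    then have Dc: "D c = of_nat n * a * c" by (simp add: r_def c_def)
    have "\<theta> \<noteq> 0" using th(2) is_subfieldD(2)[OF K'] by auto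
    have "c \<noteq> 0"
    proof
      assume "c = 0"
      then obtain p' where p': "p = pCons 0 p'" by (metis c_def coeff_pCons_0 pCons_cases)
      then have "p' \<in> polys F" "poly p' \<theta> = 0" "p' \<noteq> 0" "degree p' < degree p"
        using p \<open>\<theta> \<noteq> 0\<close> by (auto simp: polys_pCons)
      then show False using min by blast
    qed
    have "c \<notin> K"
    proof
      assume "c \<in> K"
      have "\<theta> ^ (n - 1) * \<theta> = \<theta> ^ n" using n by (metis power_minus_mult)
      then have "D (\<theta> ^ n) = of_nat n * a * \<theta> ^ n"
        unfolding D_power a(2) by (metis mult.assoc mult.left_commute)
      then have "D (\<theta> ^ n / c) = 0" using \<open>c \<noteq> 0\<close> by (simp add: D_divide Dc)
      then have "\<theta> ^ n / c \<in> K" using cK by (auto simp: constants_def)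
      then have "\<theta> ^ n / c * c \<in> K" using \<open>c \<in> K\<close> by (rule is_subfieldD(5)[OF K'])
      then have thn: "\<theta> ^ n \<in> K" using \<open>c \<noteq> 0\<close> by simp
      \<comment> \<open>\<open>\<theta>\<close> would be a root of
        \<open>X ^ n - \<theta> ^ n\<close> over \<open>K\<close>, although \<open>K\<close> is
        relatively algebraically closed.\<close>
      have "monom 1 n - [:\<theta> ^ n:] \<in> polys K"
        using thn is_subfieldD[OF K']
        by (intro polys_diff K' polys_const) (auto simp: polys_def)
      moreover have "poly (monom 1 n - [:\<theta> ^ n:]) \<theta> = 0" by (simp add: poly_monom)
      moreover have "coeff (monom 1 n - [:\<theta> ^ n:]) n \<noteq> 0"
        using n by (cases n) simp_all
      then have "monom 1 n - [:\<theta> ^ n:] \<noteq> 0" by (metis coeff_0)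
      ultimately have "\<theta> \<in> acl K" unfolding acl_def by blast
      then show False using th(2) K by (auto simp: dclosed_def)
    qed
    moreover have "of_nat n * a \<in> K" using a ofn is_subfieldD(5)[OF K'] by blast
    ultimately show ?thesis using that[of c] pF[of 0] Dc c_def by blast
  qed
qed

end

section \<open>The Wronskian of two polynomials\<close>

text \<open>The numerator of the derivative of \<open>P / Q\<close> over the denominator
  \<open>Q * Q\<close>.\<close>

definition wronskian :: "'a::field poly \<Rightarrow> 'a poly \<Rightarrow> 'a poly" where
  "wronskian P Q = pderiv P * Q - P * pderiv Q"

lemma lead_coeff_pderiv_nat:
  fixes P :: "'a::field_char_0 poly"
  shows "lead_coeff (pderiv P) = of_nat (degree P) * lead_coeff P"
proof (cases "degree P")
  case 0
  then have "pderiv P = 0" by (simp add: pderiv_eq_0_iff)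
  then show ?thesis using 0 by simp
next
  case (Suc n)
  then show ?thesis by (simp add: degree_pderiv coeff_pderiv del: of_nat_Suc)
qed

text \<open>The leading coefficients of the two products differ only by the factors
  \<open>degree P\<close> and \<open>degree Q\<close>, which characteristic zero keeps
  apart.\<close>

lemma wronskian_eq_0_imp_degree_eq:
  fixes P Q :: "'a::field_char_0 poly"
  assumes "wronskian P Q = 0" "P \<noteq> 0" "Q \<noteq> 0"
  shows "degree P = degree Q"
proof -
  have "lead_coeff (pderiv P * Q) = lead_coeff (P * pderiv Q)"
    using assms(1) by (simp add: wronskian_def)
  then have "(of_nat (degree P) :: 'a) * (lead_coeff P * lead_coeff Q)
      = of_nat (degree Q) * (lead_coeff P * lead_coeff Q)"
    unfolding lead_coeff_mult lead_coeff_pderiv_nat by (simp add: mult_ac)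
  then show ?thesis using assms(2,3) by simp
qed

text \<open>Subtracting the multiple of \<open>Q\<close> that cancels the top coefficient preserves
  the zero Wronskian, but a nonzero remainder would again need the degree of
  \<open>Q\<close>.\<close>

lemma wronskian_eq_0_imp_proportional:
  fixes P Q :: "'a::field_char_0 poly"
  assumes W: "wronskian P Q = 0" and "P \<noteq> 0" "Q \<noteq> 0"
  shows "P = smult (lead_coeff P / lead_coeff Q) Q"
proof (rule ccontr)
  define c where "c = lead_coeff P / lead_coeff Q"
  define T where "T = P - smult c Q"
  assume "P \<noteq> smult (lead_coeff P / lead_coeff Q) Q"
  then have "T \<noteq> 0" by (simp add: T_def c_def)
  have "wronskian T Q = 0"
    using W by (simp add: wronskian_def T_def pderiv_diff pderiv_smult algebra_simps)
  then have "degree T = degree Q"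
    using wronskian_eq_0_imp_degree_eq \<open>T \<noteq> 0\<close> assms(3) by blast
  moreover have "coeff T (degree Q) = 0"
    using wronskian_eq_0_imp_degree_eq[OF assms] assms(3) by (simp add: T_def c_def)
  ultimately show False using \<open>T \<noteq> 0\<close> by (metis leading_coeff_0_iff)
qed

text \<open>The extra factor \<open>L\<close> keeps the exponent \<open>i - 1\<close> out of the
  formula, which is thus uniform in \<open>i\<close>, including 0.\<close>

lemma linear_factor_pderiv:
  fixes w :: "'a::field_char_0" and p :: "'a poly"
  defines "L \<equiv> [:- w, 1:]"
  shows "L * pderiv (L ^ i * p) = L ^ i * (smult (of_nat i) p + L * pderiv p)"
proof (cases i)
  case (Suc k)
  have "pderiv L = 1" by (simp add: L_def pderiv_pCons)
  then show ?thesis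
    unfolding Suc pderiv_mult pderiv_power_Suc by (simp add: algebra_simps del: of_nat_Suc)
qed simp

text \<open>If \<open>p\<close> and \<open>q\<close> do not vanish at \<open>w\<close>, then
  \<open>i - j\<close> is the order of \<open>P / Q\<close> there; evaluating the bracket at
  \<open>w\<close> isolates it.\<close>

lemma wronskian_factor:
  fixes w :: "'a::field_char_0" and p q :: "'a poly"
  defines "L \<equiv> [:- w, 1:]"
  shows "L * wronskian (L ^ i * p) (L ^ j * q)
    = L ^ (i + j) * (smult (of_nat i - of_nat j) (p * q) + L * wronskian p q)"
proof -
  have "L * wronskian (L ^ i * p) (L ^ j * q)
      = (L * pderiv (L ^ i * p)) * (L ^ j * q) - (L ^ i * p) * (L * pderiv (L ^ j * q))"
    by (simp add: wronskian_def algebra_simps)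
  also have "\<dots> = L ^ (i + j) * (smult (of_nat i) p * q - p * smult (of_nat j) q + L * wronskian p q)"
    unfolding L_def linear_factor_pderiv by (simp only: wronskian_def power_add) algebra
  finally show ?thesis by (simp add: smult_diff_left)
qed

lemma root_factor:
  fixes u :: "'a::field_char_0 poly"
  assumes "poly u w = 0"
  obtains u1 where "u = [:- w, 1:] * u1" "poly u1 w = poly (pderiv u) w"
proof -
  obtain u1 where u1: "u = [:- w, 1:] * u1" using assms by (metis dvdE poly_eq_0_iff_dvd)
  have "poly (pderiv u) w = poly u1 w"
    unfolding u1 pderiv_mult by (simp add: pderiv_pCons)
  then show ?thesis using that u1 by simp
qed

text \<open>The hypothesis makes \<open>\<gamma> v / u\<close> the derivative of the rational function \<open>P / Q\<close>, which has no residues.\<close>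

lemma log_residue:
  fixes u v P Q :: "'a::field_char_0 poly"
  assumes eq: "u * wronskian P Q = smult \<gamma> (v * (Q * Q))"
    and nz: "\<gamma> \<noteq> 0" "P \<noteq> 0" "Q \<noteq> 0" and w: "poly u w = 0"
  shows "poly v w * poly (pderiv u) w = 0"
proof -
  define L where "L = [:- w, 1:]"
  have L: "L \<noteq> 0" "poly L w = 0" by (simp_all add: L_def)
  obtain u1 where u1: "u = L * u1" "poly u1 w = poly (pderiv u) w"
    using root_factor[OF w] unfolding L_def by blast
  obtain i p where p: "P = L ^ i * p" "\<not> L dvd p" using order_decomp[OF nz(2)] L_def by blast
  obtain j q where q: "Q = L ^ j * q" "\<not> L dvd q" using order_decomp[OF nz(3)] L_def by blast
  have pq: "poly p w \<noteq> 0" "poly q w \<noteq> 0" using p q by (auto simp: poly_eq_0_iff_dvd L_def)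
  define Z where "Z = smult (of_nat i - of_nat j) (p * q) + L * wronskian p q"
  have "u1 * (L * wronskian P Q) = smult \<gamma> (v * (Q * Q))"
    using eq by (simp add: u1(1) mult_ac)
  then have *: "u1 * (L ^ (i + j) * Z) = smult \<gamma> (v * (L ^ (j + j) * (q * q)))"
    unfolding Z_def p(1) q(1) L_def wronskian_factor by (simp add: power_add mult_ac)
  have Zw: "poly Z w = (of_nat i - of_nat j) * (poly p w * poly q w)" by (simp add: Z_def L)
  show ?thesis
  proof (cases "i \<ge> j")
    case True
    \<comment> \<open>\<open>P / Q\<close> has no pole at \<open>w\<close>. The left side then
      vanishes at \<open>w\<close>, through \<open>L ^ k\<close> if \<open>k > 0\<close> and through
      \<open>Z\<close> if \<open>k = 0\<close>, which forces \<open>poly v w = 0\<close>.\<close>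
    then obtain k where k: "i = j + k" using le_Suc_ex by blast
    have "L ^ (j + j) * (u1 * (L ^ k * Z)) = L ^ (j + j) * (smult \<gamma> (v * (q * q)))"
      using * by (simp add: k power_add mult_ac)
    then have "u1 * (L ^ k * Z) = smult \<gamma> (v * (q * q))"
      by (rule mult_left_cancel[OF power_not_zero[OF L(1)], THEN iffD1])
    from arg_cong[OF this, of "\<lambda>x. poly x w"] show ?thesis
      using nz pq L Zw by (cases k) (auto simp: k)
  next
    case False
    \<comment> \<open>At a pole of \<open>P / Q\<close>, cancelling \<open>L ^ (i + j)\<close>
      leaves a factor \<open>L\<close> on the right, while \<open>Z\<close> does not vanish at
      \<open>w\<close>; so \<open>u1\<close> does, and \<open>w\<close> is a multiple root of
      \<open>u\<close>.\<close>
    then obtain k where k: "j = Suc (i + k)" using less_imp_Suc_add[of i j] by auto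
    have "L ^ (i + j) * (u1 * Z) = L ^ (i + j) * (L * smult \<gamma> (v * (L ^ k * (q * q))))"
      using * by (simp add: k power_add mult_ac)
    then have "u1 * Z = L * smult \<gamma> (v * (L ^ k * (q * q)))"
      by (rule mult_left_cancel[OF power_not_zero[OF L(1)], THEN iffD1])
    from arg_cong[OF this, of "\<lambda>x. poly x w"] have "poly u1 w * poly Z w = 0" using L by simp
    moreover have "(of_nat i :: 'a) - of_nat j \<noteq> 0" using False by simp
    ultimately show ?thesis using pq u1(2) by (simp add: Zw)
  qed
qed

text \<open>Here \<open>\<gamma> v / u\<close> is the logarithmic derivative of \<open>P / Q\<close>, whose residues are integers.\<close>

lemma exp_residue:
  fixes u v P Q :: "'a::field_char_0 poly"
  assumes eq: "u * wronskian P Q = smult \<gamma> (v * (P * Q))"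
    and nz: "P \<noteq> 0" "Q \<noteq> 0" and w: "poly u w = 0"
  obtains m :: int where "of_int m * poly (pderiv u) w = \<gamma> * poly v w"
proof -
  define L where "L = [:- w, 1:]"
  have L: "L \<noteq> 0" "poly L w = 0" by (simp_all add: L_def)
  obtain u1 where u1: "u = L * u1" "poly u1 w = poly (pderiv u) w"
    using root_factor[OF w] unfolding L_def by blast
  obtain i p where p: "P = L ^ i * p" "\<not> L dvd p" using order_decomp[OF nz(1)] L_def by blast
  obtain j q where q: "Q = L ^ j * q" "\<not> L dvd q" using order_decomp[OF nz(2)] L_def by blast
  have pq: "poly p w \<noteq> 0" "poly q w \<noteq> 0" using p q by (auto simp: poly_eq_0_iff_dvd L_def)
  define Z where "Z = smult (of_nat i - of_nat j) (p * q) + L * wronskian p q"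
  have "u1 * (L * wronskian P Q) = smult \<gamma> (v * (P * Q))"
    using eq by (simp add: u1(1) mult_ac)
  then have "L ^ (i + j) * (u1 * Z) = L ^ (i + j) * smult \<gamma> (v * (p * q))"
    unfolding Z_def p(1) q(1) L_def wronskian_factor by (simp add: power_add mult_ac)
  then have "u1 * Z = smult \<gamma> (v * (p * q))"
    by (rule mult_left_cancel[OF power_not_zero[OF L(1)], THEN iffD1])
  from arg_cong[OF this, of "\<lambda>x. poly x w"]
  have "poly u1 w * (of_nat i - of_nat j) * (poly p w * poly q w) = \<gamma> * poly v w * (poly p w * poly q w)"
    by (simp add: Z_def L mult_ac)
  \<comment> \<open>The integer is the order of \<open>P / Q\<close> at \<open>w\<close>, that is,
    the residue of its logarithmic derivative.\<close>
  then have "of_int (int i - int j) * poly (pderiv u) w = \<gamma> * poly v w"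
    using pq u1(2) by (simp add: mult_ac)
  then show ?thesis using that by blast
qed

section \<open>The Liouville step\<close>

context derivation
begin

text \<open>The identity required of \<open>R\<close> says \<open>(V / R)' = D (W / R)\<close>, with \<open>D\<close> acting on coefficients; it makes
  the part of the derivative of \<open>P / Q\<close> that comes from \<open>D s\<close> a constant.\<close>

lemma constant_ratio:
  fixes P Q R :: "'a poly"
  defines "V \<equiv> Dp P * Q - P * Dp Q" and "W \<equiv> wronskian P Q"
  assumes K: "dclosed K" and s: "s \<notin> K"
    and u: "u \<in> polys constants" and v: "v \<in> polys constants" "v \<noteq> 0"
    and ode: "poly v s * D s = poly u s"
    and PQ: "P \<in> polys K" "Q \<in> polys K" and R: "R \<in> polys K" "R \<noteq> 0"
    and R_id: "pderiv V * R - V * pderiv R = Dp W * R - W * Dp R"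
    and b: "b \<in> K" "poly V s + D s * poly W s = b * poly R s"
  shows "\<exists>\<gamma>. D \<gamma> = 0 \<and> u * W = smult \<gamma> (v * R)"
proof -
  have K': "is_subfield K" and dK: "dsubfield K" and cK: "constants \<subseteq> K" and aK: "acl K \<subseteq> K"
    using K by (auto simp: dsubfield_def dclosed_def)
  note KR = is_subfieldD(1)[OF K']
  have trans: "p = 0" if "p \<in> polys K" "poly p s = 0" for p
    using that s aK by (auto simp: acl_def)
  have uK: "u \<in> polys K" "v \<in> polys K" using u v polys_mono[OF cK] by auto
  have VK: "V \<in> polys K" and WK: "W \<in> polys K"
    unfolding V_def W_def wronskian_def using PQ
    by (auto intro!: polys_diff polys_mult polys_pderiv Dp_in_polys K' KR dK)
  define v' r where "v' = poly v s" and "r = poly R s"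
  have nz: "v' \<noteq> 0" "r \<noteq> 0" using trans uK(2) v(2) R by (auto simp: v'_def r_def)
  \<comment> \<open>Multiplied by \<open>poly v s\<close>, the relation becomes a polynomial over
    \<open>K\<close> evaluated at \<open>s\<close>. By transcendence the polynomial itself is zero,
    so its coefficients may be differentiated.\<close>
  have "v * V + u * W - smult b (v * R) = 0"
  proof (rule trans)
    show "v * V + u * W - smult b (v * R) \<in> polys K"
      by (intro polys_diff polys_add polys_mult polys_smult K' KR uK VK WK R b)
    have "poly (v * V + u * W - smult b (v * R)) s = v' * (poly V s + D s * poly W s - b * r)"
      by (simp add: v'_def r_def ode[symmetric] algebra_simps)
    then show "poly (v * V + u * W - smult b (v * R)) s = 0" using b(2) by (simp add: r_def)
  qed
  then have "v * V + u * W = smult b (v * R)" by simp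
  then have "Dp (v * V + u * W) = Dp (smult b (v * R))" by simp
  then have "v * Dp V + u * Dp W = smult (D b) (v * R) + smult b (v * Dp R)"
    by (simp add: Dp_add Dp_mult Dp_smult Dp_constants[OF u] Dp_constants[OF v(1)])
  from arg_cong[OF this, of "\<lambda>p. poly p s"]
  have "v' * (poly (Dp V) s + D s * poly (Dp W) s) = v' * (D b * r + b * poly (Dp R) s)"
    by (simp add: v'_def r_def ode[symmetric] algebra_simps)
  then have key: "poly (Dp V) s + D s * poly (Dp W) s = D b * r + b * poly (Dp R) s"
    using nz by simp
  have R_id': "poly (pderiv V) s * r - poly V s * poly (pderiv R) s
      = poly (Dp W) s * r - poly W s * poly (Dp R) s"
    using arg_cong[OF R_id, of "\<lambda>p. poly p s"] by (simp add: r_def)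
  \<comment> \<open>This says \<open>D (V(s) / R(s)) = D b\<close>: \<open>R_id'\<close> trades
    derivatives in the variable for \<open>D\<close> on coefficients, and \<open>key\<close>
    evaluates the result.\<close>
  have D_ratio: "D (poly V s) * r - poly V s * D r = D b * r\<^sup>2"
    using key R_id' b(2) unfolding D_poly r_def by algebra
  \<comment> \<open>By the relation for \<open>b\<close>, this is
    \<open>D s * W(s) / R(s)\<close>.\<close>
  define \<gamma> where "\<gamma> = b - poly V s / r"
  have "D \<gamma> = 0"
    using D_ratio nz by (simp add: \<gamma>_def D_diff D_divide)
  moreover have \<gamma>: "D s * poly W s = \<gamma> * r"
    using b(2) nz unfolding r_def[symmetric] by (simp add: \<gamma>_def left_diff_distrib eq_diff_eq add.commute)
  have "u * W - smult \<gamma> (v * R) = 0"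
  proof (rule trans)
    have "\<gamma> \<in> K" using \<open>D \<gamma> = 0\<close> cK by (auto simp: constants_def)
    then show "u * W - smult \<gamma> (v * R) \<in> polys K"
      by (intro polys_diff polys_mult polys_smult K' KR uK WK R)
    have "poly (u * W - smult \<gamma> (v * R)) s = v' * (D s * poly W s - \<gamma> * r)"
      by (simp add: v'_def r_def ode[symmetric] algebra_simps)
    then show "poly (u * W - smult \<gamma> (v * R)) s = 0" using \<gamma> by simp
  qed
  ultimately show ?thesis by auto
qed

text \<open>With \<open>q = P(s) / Q(s)\<close>, clearing denominators turns \<open>D q = b\<close>
  into a relation with \<open>R = Q * Q\<close>, and \<open>D q = b * q\<close> into one with
  \<open>R = P * Q\<close>, because one factor \<open>Q\<close> cancels.\<close>

lemma liouville_step: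
  assumes K: "dclosed K" and s: "s \<notin> K"
    and u: "u \<in> polys constants" "u \<noteq> 0" and v: "v \<in> polys constants" "v \<noteq> 0"
    and ode: "poly v s * D s = poly u s"
    and q: "q \<in> ratf K s" "q \<notin> K" "D q \<in> K \<or> (\<exists>b\<in>K. D q = b * q)"
  shows "\<exists>\<gamma> P Q. D \<gamma> = 0 \<and> \<gamma> \<noteq> 0 \<and> P \<noteq> 0 \<and> Q \<noteq> 0 \<and>
    (u * wronskian P Q = smult \<gamma> (v * (Q * Q)) \<or> u * wronskian P Q = smult \<gamma> (v * (P * Q)))"
proof -
  have K': "is_subfield K" using K by (auto simp: dsubfield_def dclosed_def)
  note KR = is_subfieldD(1)[OF K']
  obtain P Q where PQ: "P \<in> polys K" "Q \<in> polys K" "poly Q s \<noteq> 0" "q = poly P s / poly Q s"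
    by (rule ratfE[OF K' q(1)])
  have "q \<noteq> 0" using q(2) is_subfieldD(2)[OF K'] by auto
  then have nz: "P \<noteq> 0" "Q \<noteq> 0" using PQ by auto
  \<comment> \<open>A zero Wronskian would make \<open>q\<close> a ratio of leading coefficients,
    hence an element of \<open>K\<close>.\<close>
  have W: "wronskian P Q \<noteq> 0"
  proof
    assume "wronskian P Q = 0"
    then have "P = smult (lead_coeff P / lead_coeff Q) Q"
      using wronskian_eq_0_imp_proportional nz by blast
    then have "poly P s = lead_coeff P / lead_coeff Q * poly Q s" by (metis poly_smult)
    then have "q = lead_coeff P / lead_coeff Q" using PQ by simp
    moreover have "lead_coeff P / lead_coeff Q \<in> K"
      using PQ by (intro is_subfieldD(9)[OF K']) (auto simp: polys_def)
    ultimately show False using q(2) by simp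
  qed
  define V where "V = Dp P * Q - P * Dp Q"
  have Dq: "poly V s + D s * poly (wronskian P Q) s = D q * (poly Q s)\<^sup>2"
    unfolding PQ(4) D_divide[OF PQ(3)] using PQ(3)
    by (simp add: V_def wronskian_def D_poly) (simp add: algebra_simps)
  have "\<exists>\<gamma>. D \<gamma> = 0 \<and>
    (u * wronskian P Q = smult \<gamma> (v * (Q * Q)) \<or> u * wronskian P Q = smult \<gamma> (v * (P * Q)))"
    using q(3)
  proof
    assume "D q \<in> K"
    have "\<exists>\<gamma>. D \<gamma> = 0 \<and> u * wronskian P Q = smult \<gamma> (v * (Q * Q))"
    proof (rule constant_ratio[OF K s u(1) v ode PQ(1,2) _ _ _ \<open>D q \<in> K\<close>])
      show "poly (Dp P * Q - P * Dp Q) s + D s * poly (wronskian P Q) s = D q * poly (Q * Q) s"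
        using Dq by (simp add: V_def power2_eq_square)
      show "pderiv (Dp P * Q - P * Dp Q) * (Q * Q) - (Dp P * Q - P * Dp Q) * pderiv (Q * Q)
          = Dp (wronskian P Q) * (Q * Q) - wronskian P Q * Dp (Q * Q)"
        by (simp add: wronskian_def pderiv_diff pderiv_mult Dp_diff Dp_mult pderiv_Dp) algebra
    qed (use PQ nz KR in \<open>auto intro: polys_mult\<close>)
    then show ?thesis by blast
  next
    assume "\<exists>b\<in>K. D q = b * q"
    then obtain b where b: "b \<in> K" "D q = b * q" by blast
    have "\<exists>\<gamma>. D \<gamma> = 0 \<and> u * wronskian P Q = smult \<gamma> (v * (P * Q))"
    proof (rule constant_ratio[OF K s u(1) v ode PQ(1,2) _ _ _ b(1)])
      show "poly (Dp P * Q - P * Dp Q) s + D s * poly (wronskian P Q) s = b * poly (P * Q) s"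
        using Dq PQ(3) by (simp add: V_def power2_eq_square b(2)) (simp add: PQ(4))
      show "pderiv (Dp P * Q - P * Dp Q) * (P * Q) - (Dp P * Q - P * Dp Q) * pderiv (P * Q)
          = Dp (wronskian P Q) * (P * Q) - wronskian P Q * Dp (P * Q)"
        by (simp add: wronskian_def pderiv_diff pderiv_mult Dp_diff Dp_mult pderiv_Dp) algebra
    qed (use PQ nz KR in \<open>auto intro: polys_mult\<close>)
    then show ?thesis by blast
  qed
  then obtain \<gamma> where \<gamma>: "D \<gamma> = 0"
    "u * wronskian P Q = smult \<gamma> (v * (Q * Q)) \<or> u * wronskian P Q = smult \<gamma> (v * (P * Q))" by blast
  moreover have "\<gamma> \<noteq> 0" using \<gamma>(2) W u(2) by auto
  ultimately show ?thesis using nz by blast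
qed

end

section \<open>The equation for a root of the solution\<close>

text \<open>Each product loses a degree by differentiation; this is the vanishing at infinity of the
  logarithmic derivative of \<open>P / Q\<close>.\<close>

lemma degree_wronskian:
  fixes P Q :: "'a::field_char_0 poly"
  assumes "wronskian P Q \<noteq> 0"
  shows "degree (wronskian P Q) < degree P + degree Q"
proof -
  have d: "degree (pderiv P * Q) < degree P + degree Q"
    if "degree P + degree Q > 0" for P Q :: "'a poly"
  proof (cases "degree P = 0")
    case True
    then have "pderiv P = 0" by (simp add: pderiv_eq_0_iff)
    then show ?thesis using that by simp
  next
    case False
    have "degree (pderiv P * Q) \<le> degree (pderiv P) + degree Q" by (rule degree_mult_le)
    then show ?thesis using False by (simp add: degree_pderiv)
  qed
  have "degree P + degree Q > 0"
  proof (rule ccontr)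
    assume "\<not> degree P + degree Q > 0"
    then have "pderiv P = 0" "pderiv Q = 0" by (simp_all add: pderiv_eq_0_iff)
    then show False using assms by (simp add: wronskian_def)
  qed
  then show ?thesis
    unfolding wronskian_def using d[of P Q] d[of Q P]
    by (intro degree_diff_less) (simp_all add: mult.commute add.commute)
qed

text \<open>For \<open>y' = C (1 - y powr (A / B))\<close> and \<open>s = y powr (1 / B)\<close> this is the equation satisfied by \<open>s\<close>.\<close>

locale root_equation = derivation +
  fixes A B :: nat and c s \<zeta> :: 'a
  assumes AB: "A > 0" "B > 0" "coprime A B"
    and c: "c \<noteq> 0" "D c = 0"
    and ode: "of_nat B * s ^ (B - 1) * D s = c * (1 - s ^ A)"
    and zeta: "\<zeta> ^ A = 1" "\<And>k. \<zeta> ^ k = 1 \<Longrightarrow> A dvd k"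
begin

definition u :: "'a poly" where "u = smult c (1 - monom 1 A)"

definition v :: "'a poly" where "v = monom (of_nat B) (B - 1)"

lemma poly_u: "poly u x = c * (1 - x ^ A)" and poly_v: "poly v x = of_nat B * x ^ (B - 1)"
  by (simp_all add: u_def v_def poly_monom)

lemma degree_u: "degree u = A"
proof -
  have "1 - monom 1 A = - (monom 1 A - 1 :: 'a poly)" by simp
  moreover have "degree (monom 1 A + (- 1) :: 'a poly) = degree (monom 1 A :: 'a poly)"
    using AB(1) by (intro degree_add_eq_left) (simp add: degree_monom_eq)
  ultimately show ?thesis using c(1) unfolding u_def
    by (metis degree_minus degree_monom_eq degree_smult_eq diff_conv_add_uminus one_neq_zero)
qed

lemma u_nz: "u \<noteq> 0"
  using degree_u AB(1) by force

lemma v_nz: "v \<noteq> 0"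
  using AB(2) by (simp add: v_def)

lemma uv_constants: "u \<in> polys constants" "v \<in> polys constants"
  using c(2) by (auto simp: polys_def constants_def u_def v_def D_mult D_diff coeff_monom coeff_1)

text \<open>The factor \<open>w\<close> removes the exponents \<open>A - 1\<close> and
  \<open>B - 1\<close>; the second value divided by the first is the residue of \<open>v / u\<close>
  at \<open>w\<close>.\<close>

lemma residue_equation:
  assumes "w ^ A = 1"
  shows "w * poly (pderiv u) w = - (of_nat A * c)" "w * poly v w = of_nat B * w ^ B"
proof -
  have "w * poly (pderiv u) w = - (c * of_nat A * (w * w ^ (A - 1)))"
    by (simp add: u_def pderiv_smult pderiv_diff pderiv_monom poly_monom)
  also have "w * w ^ (A - 1) = 1" using assms AB(1) by (cases A) simp_all
  finally show "w * poly (pderiv u) w = - (of_nat A * c)" by (simp add: mult.commute)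
  show "w * poly v w = of_nat B * w ^ B"
    using AB(2) by (simp add: poly_v power_eq_if[of w B])
qed

lemma exponents_of_wronskian_equation:
  assumes g: "\<gamma> \<noteq> 0" "P \<noteq> 0" "Q \<noteq> 0"
    and eq: "u * wronskian P Q = smult \<gamma> (v * (Q * Q)) \<or> u * wronskian P Q = smult \<gamma> (v * (P * Q))"
  shows "A \<in> {1, 2} \<and> B = 1"
proof -
  have root: "poly u w = 0" if "w ^ A = 1" for w using that by (simp add: poly_u)
  have "u * wronskian P Q \<noteq> smult \<gamma> (v * (Q * Q))"
  proof
    assume "u * wronskian P Q = smult \<gamma> (v * (Q * Q))"
    \<comment> \<open>At the root 1, \<open>pderiv u\<close> and \<open>v\<close> take the nonzero
      values \<open>- A c\<close> and \<open>B\<close>.\<close>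
    from log_residue[OF this g root[of 1]] show False
      using residue_equation[of 1] AB c(1) by simp
  qed
  then have eq': "u * wronskian P Q = smult \<gamma> (v * (P * Q))" using eq by blast
  have res: "\<exists>m::int. of_int m * - (of_nat A * c) = \<gamma> * (of_nat B * w ^ B)" if w: "w ^ A = 1" for w
  proof -
    obtain m :: int where m: "of_int m * poly (pderiv u) w = \<gamma> * poly v w"
      by (rule exp_residue[OF eq' g(2,3) root[OF w]])
    have "of_int m * (w * poly (pderiv u) w) = \<gamma> * (w * poly v w)"
      using m by (simp add: mult.left_commute)
    then show ?thesis unfolding residue_equation[OF w] by blast
  qed
  \<comment> \<open>The residues at 1 and at the primitive root \<open>\<zeta>\<close> are compared;
    their ratio \<open>\<zeta> ^ B\<close> no longer involves \<open>\<gamma>\<close>.\<close>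
  obtain m0 :: int where m0: "of_int m0 * - (of_nat A * c) = \<gamma> * of_nat B" using res[of 1] by auto
  obtain m1 :: int where m1: "of_int m1 * - (of_nat A * c) = \<gamma> * (of_nat B * \<zeta> ^ B)"
    using res[OF zeta(1)] by auto
  have "of_int m1 * - (of_nat A * c) = (of_int m0 * \<zeta> ^ B) * - (of_nat A * c)"
    unfolding m1 mult.assoc[symmetric] m0[symmetric] by (simp add: mult_ac)
  then have m10: "of_int m1 = of_int m0 * \<zeta> ^ B" using AB(1) c(1) by simp
  have "m0 \<noteq> 0" using m0 g(1) AB(2) by auto
  \<comment> \<open>A rational root of unity is 1 or -1; here this is expressed through the integers
    \<open>m0\<close> and \<open>m1\<close>.\<close>
  have "(\<zeta> ^ B) ^ A = 1" using zeta(1) by (metis mult.commute power_mult power_one)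
  then have "(of_int (m1 ^ A) :: 'a) = of_int (m0 ^ A)" by (simp add: m10 power_mult_distrib)
  then have "m1 ^ A = m0 ^ A" by (simp only: of_int_eq_iff)
  then have "\<bar>m1\<bar> ^ A = \<bar>m0\<bar> ^ A" by (metis power_abs)
  then have "\<bar>m1\<bar> = \<bar>m0\<bar>" using AB(1) by (simp add: power_eq_iff_eq_base)
  then have "m1\<^sup>2 = m0\<^sup>2" by (metis power2_abs)
  then have "(of_int m1 :: 'a)\<^sup>2 = (of_int m0)\<^sup>2" by (metis of_int_power)
  then have "\<zeta> ^ (B * 2) = 1" using \<open>m0 \<noteq> 0\<close> by (simp add: m10 power_mult_distrib power_mult)
  then have "A dvd B * 2" by (rule zeta(2))
  then have "A dvd 2" using AB(3) by (simp add: coprime_dvd_mult_right_iff)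
  then have "A \<le> 2" by (rule dvd_imp_le) simp
  then have A: "A = 1 \<or> A = 2" using AB(1) by linarith
  have "smult \<gamma> (v * (P * Q)) \<noteq> 0" using g v_nz by simp
  then have W: "wronskian P Q \<noteq> 0" using eq' by auto
  \<comment> \<open>Comparing degrees in \<open>eq'\<close> gives
    \<open>A + degree W = B - 1 + degree P + degree Q\<close>, where \<open>W\<close> is the
    Wronskian, of degree strictly below \<open>degree P + degree Q\<close>.\<close>
  have "degree (u * wronskian P Q) = A + degree (wronskian P Q)"
    using W u_nz by (simp add: degree_mult_eq degree_u)
  moreover have "degree (smult \<gamma> (v * (P * Q))) = B - 1 + (degree P + degree Q)"
    using g v_nz AB(2) by (simp add: degree_mult_eq v_def degree_monom_eq)
  ultimately have "B - 1 < A" using eq' degree_wronskian[OF W] by simp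
  then have "B \<le> A" by linarith
  then show ?thesis using A AB(2,3) by (cases "B = 2") auto
qed

lemma adjoin_log_exp:
  assumes K: "dclosed K" "s \<notin> K" and th: "D \<theta> \<in> K \<or> (\<exists>a\<in>K. D \<theta> = a * \<theta>)"
    and AB': "\<not> (A \<in> {1, 2} \<and> B = 1)"
  obtains K' where "dclosed K'" "s \<notin> K'" "K \<subseteq> K'" "\<theta> \<in> K'"
proof (cases "\<theta> \<in> K")
  case False
  have K': "is_subfield K" "dsubfield K" "constants \<subseteq> K" "acl K \<subseteq> K"
    using K(1) by (auto simp: dclosed_def dsubfield_def)
  have KR: "K \<subseteq> ratf K x" for x by (rule subset_ratf[OF K'(1)])
  note E = is_subfieldD[OF is_subfield_ratf[OF K'(1)]]
  have "D \<theta> \<in> ratf K \<theta>"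
    using th KR[of \<theta>] E(5)[OF _ generator_in_ratf[OF K'(1)]] by auto
  then have dE: "dsubfield (ratf K \<theta>)" by (rule dsubfield_ratf[OF K'(2)])
  define K1 where "K1 = acl (ratf K \<theta>)"
  have "dclosed K1" unfolding K1_def using dclosed_acl[OF dE] KR[of \<theta>] K'(3) by blast
  moreover have sub: "ratf K \<theta> \<subseteq> K1"
    unfolding K1_def by (rule subset_acl[OF is_subfield_ratf[OF K'(1)]])
  moreover have "s \<notin> K1"
  proof
    assume "s \<in> K1"
    then have th_s: "\<theta> \<in> acl (ratf K s)"
      using acl_exchange[OF K'(1), of s \<theta>] K(2) K'(4) unfolding K1_def by blast
    have uvK: "u \<in> polys K" "v \<in> polys K" using uv_constants polys_mono[OF K'(3)] by auto
    \<comment> \<open>By transcendence of \<open>s\<close> the equation can be solved for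
      \<open>D s\<close> within K(s), which is therefore a differential field.\<close>
    have "poly v s \<noteq> 0" using uvK v_nz K(2) K'(4) by (auto simp: acl_def)
    moreover have ode': "poly v s * D s = poly u s" using ode by (simp add: poly_u poly_v)
    ultimately have "D s = poly u s / poly v s" by (simp add: field_simps)
    then have "D s \<in> ratf K s" using ratfI[OF uvK] by simp
    then have "dsubfield (ratf K s)" by (rule dsubfield_ratf[OF K'(2)])
    from log_exp_element_descends[OF K(1) this KR th_s False th]
    obtain q where "q \<in> ratf K s" "q \<notin> K" "D q \<in> K \<or> (\<exists>b\<in>K. D q = b * q)" by blast
    from liouville_step[OF K uv_constants(1) u_nz uv_constants(2) v_nz ode' this]
    show False using exponents_of_wronskian_equation AB' by blast
  qed
  ultimately show ?thesis
    using that[of K1] KR[of \<theta>] generator_in_ratf[OF K'(1), of \<theta>] by blast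
qed (use that K in blast)

end

section \<open>Taylor expansions of elementary functions\<close>

interpretation fls: derivation "fls_deriv :: complex fls \<Rightarrow> complex fls"
  by unfold_locales simp_all

definition expansion :: "complex \<Rightarrow> (complex \<Rightarrow> complex) \<Rightarrow> complex fls" where
  "expansion z f = fps_to_fls (fps_expansion f z)"

lemma expansion_eqI:
  assumes "(\<lambda>x. f (z + x)) has_fps_expansion F"
  shows "expansion z f = fps_to_fls F"
  using fps_expansion_unique_complex[OF assms analytic_at_imp_has_fps_expansion]
    has_fps_expansion_imp_analytic[OF assms] by (simp add: expansion_def)

lemma expansion_cong:
  assumes "open D" "z \<in> D" "\<And>w. w \<in> D \<Longrightarrow> f w = g w"
  shows "expansion z f = expansion z g"
  unfolding expansion_def
  using eventually_nhds_in_open[OF assms(1,2)] assms(3)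
  by (intro arg_cong[of _ _ fps_to_fls] fps_expansion_cong) (auto elim: eventually_mono)

lemma expansion_const: "expansion z (\<lambda>_. c) = fls_const c"
  using expansion_eqI[OF has_fps_expansion_const] by simp

lemma expansion_ident: "expansion z (\<lambda>z. z) = fls_const z + fls_X"
proof -
  have "(\<lambda>x. z + x) has_fps_expansion fps_const z + fps_X" by (intro fps_expansion_intros)
  from expansion_eqI[OF this] show ?thesis by simp
qed

context
  fixes f g :: "complex \<Rightarrow> complex" and z :: complex
  assumes f: "f analytic_on {z}" and g: "g analytic_on {z}"
begin

lemma expansion_add: "expansion z (\<lambda>w. f w + g w) = expansion z f + expansion z g"
  using expansion_eqI[OF has_fps_expansion_add[OF f[THEN analytic_at_imp_has_fps_expansion]
        g[THEN analytic_at_imp_has_fps_expansion]]]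
  by (simp add: expansion_def)

lemma expansion_diff: "expansion z (\<lambda>w. f w - g w) = expansion z f - expansion z g"
  using expansion_eqI[OF has_fps_expansion_diff[OF f[THEN analytic_at_imp_has_fps_expansion]
        g[THEN analytic_at_imp_has_fps_expansion]]]
  by (simp add: expansion_def)

lemma expansion_mult: "expansion z (\<lambda>w. f w * g w) = expansion z f * expansion z g"
  using expansion_eqI[OF has_fps_expansion_mult[OF f[THEN analytic_at_imp_has_fps_expansion]
        g[THEN analytic_at_imp_has_fps_expansion]]]
  by (simp add: expansion_def fls_times_fps_to_fls)

end

lemma expansion_power:
  assumes "f analytic_on {z}"
  shows "expansion z (\<lambda>w. f w ^ n) = expansion z f ^ n"
  using assms by (induction n) (simp_all add: expansion_const expansion_mult analytic_on_power)

lemma expansion_sum: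
  assumes "\<And>i. i \<in> I \<Longrightarrow> f i analytic_on {z}"
  shows "expansion z (\<lambda>w. \<Sum>i\<in>I. f i w) = (\<Sum>i\<in>I. expansion z (f i))"
  using assms
  by (induction I rule: infinite_finite_induct)
     (simp_all add: expansion_const expansion_add analytic_on_sum)

lemma expansion_deriv:
  assumes "f analytic_on {z}"
  shows "expansion z (deriv f) = fls_deriv (expansion z f)"
proof -
  have "deriv (\<lambda>x. f (z + x)) = (\<lambda>x. deriv f (z + x))"
    using DERIV_shift[of f _ _ z] by (simp add: deriv_def add.commute fun_eq_iff)
  then show ?thesis
    using expansion_eqI[of "deriv f"] has_fps_expansion_deriv[OF analytic_at_imp_has_fps_expansion[OF assms]]
    by (simp add: expansion_def fls_deriv_fps_to_fls)
qed

text \<open>The identity theorem: a function that is nonzero anywhere in \<open>D\<close> has a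
  nonzero series at \<open>z\<close>.\<close>

lemma expansion_eq_0_imp:
  assumes D: "open D" "connected D" "z \<in> D" and f: "f holomorphic_on D"
    and "expansion z f = 0" and w: "w \<in> D"
  shows "f w = 0"
proof -
  have "f analytic_on {z}" using D f analytic_at by blast
  then have "(\<lambda>x. f (z + x)) has_fps_expansion 0"
    using analytic_at_imp_has_fps_expansion[of f z] assms(5) by (simp add: expansion_def)
  then have "eventually (\<lambda>x. f (z + x) = 0) (nhds 0)" by (simp add: has_fps_expansion_0_iff)
  then have "eventually (\<lambda>x. f x = 0) (nhds z)"
    by (simp add: nhds_to_0[of z] eventually_filtermap add.commute)
  then obtain S where S: "open S" "z \<in> S" "\<And>x. x \<in> S \<Longrightarrow> f x = 0" by (auto simp: eventually_nhds)
  show ?thesis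
    using analytic_continuation_open[of "S \<inter> D" D f "\<lambda>_. 0" w] S D f w by auto
qed

section \<open>Towers of fields for elementary functions\<close>

lemma elementary_holo_imp_holomorphic:
  assumes "elementary_holo D f"
  shows "f holomorphic_on D"
  using assms by (induction rule: elementary_holo.induct) (auto intro!: holomorphic_intros)

locale root_equation_fls = root_equation fls_deriv A B c s \<zeta>
  for A B :: nat and c s \<zeta> :: "complex fls" +
  assumes not_exceptional: "\<not> (A \<in> {1, 2} \<and> B = 1)"
begin

text \<open>The induction leaves \<open>K\<close> arbitrary: the field for each operand is built
  over the one found for the previous operand, so all of them end up in a single field that still
  misses \<open>s\<close>.\<close>

lemma expansion_in_tower:
  assumes "elementary_holo D f" and D: "open D" "connected D" "z \<in> D"
    and "fls.dclosed K" "s \<notin> K"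
  shows "\<exists>K'. fls.dclosed K' \<and> s \<notin> K' \<and> K \<subseteq> K' \<and> expansion z f \<in> K'"
  using assms(1,5,6)
proof (induction arbitrary: K rule: elementary_holo.induct)
  case (const c)
  have "expansion z (\<lambda>_. c) \<in> K"
    using const by (auto simp: expansion_const fls.dclosed_def fls.constants_def)
  then show ?case using const by blast
next
  case ident
  have "1 \<in> K" using ident by (auto simp: fls.dclosed_def fls.constants_def)
  \<comment> \<open>The variable has derivative 1, so it is adjoined like a logarithm.\<close>
  then have "fls_deriv (expansion z (\<lambda>z. z)) \<in> K" by (simp add: expansion_ident)
  then show ?case using adjoin_log_exp[OF ident _ not_exceptional] by metis
next
  case (add f g)
  have an: "f analytic_on {z}" "g analytic_on {z}"
    using add.hyps elementary_holo_imp_holomorphic D analytic_at by blast+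
  obtain K1 where K1: "fls.dclosed K1" "s \<notin> K1" "K \<subseteq> K1" "expansion z f \<in> K1"
    using add.IH(1)[OF add.prems] by blast
  obtain K2 where K2: "fls.dclosed K2" "s \<notin> K2" "K1 \<subseteq> K2" "expansion z g \<in> K2"
    using add.IH(2)[OF K1(1,2)] by blast
  have "is_subfield K2" using K2 by (auto simp: fls.dclosed_def fls.dsubfield_def)
  then have "expansion z (\<lambda>z. f z + g z) \<in> K2"
    unfolding expansion_add[OF an] using K1 K2 by (intro is_subfieldD(4)) auto
  then show ?case using K1 K2 by blast
next
  case (diff f g)
  have an: "f analytic_on {z}" "g analytic_on {z}"
    using diff.hyps elementary_holo_imp_holomorphic D analytic_at by blast+
  obtain K1 where K1: "fls.dclosed K1" "s \<notin> K1" "K \<subseteq> K1" "expansion z f \<in> K1"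
    using diff.IH(1)[OF diff.prems] by blast
  obtain K2 where K2: "fls.dclosed K2" "s \<notin> K2" "K1 \<subseteq> K2" "expansion z g \<in> K2"
    using diff.IH(2)[OF K1(1,2)] by blast
  have "is_subfield K2" using K2 by (auto simp: fls.dclosed_def fls.dsubfield_def)
  then have "expansion z (\<lambda>z. f z - g z) \<in> K2"
    unfolding expansion_diff[OF an] using K1 K2 by (intro is_subfieldD(8)) auto
  then show ?case using K1 K2 by blast
next
  case (mult f g)
  have an: "f analytic_on {z}" "g analytic_on {z}"
    using mult.hyps elementary_holo_imp_holomorphic D analytic_at by blast+
  obtain K1 where K1: "fls.dclosed K1" "s \<notin> K1" "K \<subseteq> K1" "expansion z f \<in> K1"
    using mult.IH(1)[OF mult.prems] by blast
  obtain K2 where K2: "fls.dclosed K2" "s \<notin> K2" "K1 \<subseteq> K2" "expansion z g \<in> K2"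
    using mult.IH(2)[OF K1(1,2)] by blast
  have "is_subfield K2" using K2 by (auto simp: fls.dclosed_def fls.dsubfield_def)
  then have "expansion z (\<lambda>z. f z * g z) \<in> K2"
    unfolding expansion_mult[OF an] using K1 K2 by (intro is_subfieldD(5)) auto
  then show ?case using K1 K2 by blast
next
  case (divide f g)
  have hol: "f holomorphic_on D" "g holomorphic_on D"
    using divide.hyps elementary_holo_imp_holomorphic by blast+
  then have "(\<lambda>z. f z / g z) holomorphic_on D" using divide.hyps by (auto intro!: holomorphic_intros)
  then have an: "g analytic_on {z}" "(\<lambda>z. f z / g z) analytic_on {z}"
    using hol D analytic_at by blast+
  obtain K1 where K1: "fls.dclosed K1" "s \<notin> K1" "K \<subseteq> K1" "expansion z f \<in> K1"
    using divide.IH(1)[OF divide.prems] by blast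
  obtain K2 where K2: "fls.dclosed K2" "s \<notin> K2" "K1 \<subseteq> K2" "expansion z g \<in> K2"
    using divide.IH(2)[OF K1(1,2)] by blast
  \<comment> \<open>The series of the quotient is read off from the product
    \<open>(f / g) * g\<close>, since the series of \<open>g\<close> is nonzero.\<close>
  have "expansion z f = expansion z (\<lambda>w. f w / g w * g w)"
    using divide.hyps by (intro expansion_cong[OF D(1,3)]) auto
  also have "\<dots> = expansion z (\<lambda>w. f w / g w) * expansion z g"
    by (rule expansion_mult[OF an(2,1)])
  finally have "expansion z f = expansion z (\<lambda>w. f w / g w) * expansion z g" .
  moreover have "expansion z g \<noteq> 0"
    using expansion_eq_0_imp[OF D hol(2) _ D(3)] divide.hyps D(3) by blast
  ultimately have "expansion z (\<lambda>w. f w / g w) = expansion z f / expansion z g"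
    by (simp add: field_simps)
  moreover have "is_subfield K2" using K2 by (auto simp: fls.dclosed_def fls.dsubfield_def)
  then have "expansion z f / expansion z g \<in> K2"
    using K1 K2 by (intro is_subfieldD(9)) auto
  ultimately show ?case using K1 K2 by auto
next
  case (algebraic n c f)
  have hol: "c i holomorphic_on D" if "i \<le> n" for i
    using algebraic.IH that elementary_holo_imp_holomorphic by blast
  have an: "f analytic_on {z}" "\<And>i. i \<le> n \<Longrightarrow> c i analytic_on {z}"
    using algebraic.hyps hol D analytic_at by blast+
  \<comment> \<open>The coefficients are adjoined one after another, by an inner induction on their
    number.\<close>
  have "\<exists>K'. fls.dclosed K' \<and> s \<notin> K' \<and> K \<subseteq> K' \<and> (\<forall>i<m. expansion z (c i) \<in> K')" if "m \<le> Suc n" for m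
    using that
  proof (induction m)
    case (Suc m)
    then obtain K1 where K1: "fls.dclosed K1" "s \<notin> K1" "K \<subseteq> K1" "\<forall>i<m. expansion z (c i) \<in> K1"
      by auto
    have "m \<le> n" using Suc.prems by simp
    then obtain K2 where "fls.dclosed K2" "s \<notin> K2" "K1 \<subseteq> K2" "expansion z (c m) \<in> K2"
      using algebraic.IH K1(1,2) by blast
    then show ?case using K1 by (intro exI[of _ K2]) (auto simp: less_Suc_eq)
  qed (use algebraic.prems in auto)
  from this[of "Suc n"] obtain K' where K': "fls.dclosed K'" "s \<notin> K'" "K \<subseteq> K'"
    "\<And>i. i \<le> n \<Longrightarrow> expansion z (c i) \<in> K'" by auto
  define p where "p = (\<Sum>i\<le>n. monom (expansion z (c i)) i)"
  have cp: "coeff p i = (if i \<le> n then expansion z (c i) else 0)" for i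
    by (simp add: p_def coeff_sum)
  have "0 \<in> K'" using K'(1) by (auto simp: fls.dclosed_def fls.constants_def)
  then have "p \<in> polys K'" using K'(4) by (auto simp: polys_def cp)
  moreover have "p \<noteq> 0"
  proof
    assume "p = 0"
    \<comment> \<open>The point \<open>w\<close> may differ from the expansion point
      \<open>z\<close>; connectedness of \<open>D\<close> bridges the two.\<close>
    obtain i w where i: "i \<le> n" "w \<in> D" "c i w \<noteq> 0" using algebraic.hyps by blast
    have "expansion z (c i) = 0" using cp[of i] i \<open>p = 0\<close> by simp
    then show False using expansion_eq_0_imp[OF D hol[OF i(1)] _ i(2)] i(3) by blast
  qed
  moreover have "poly p (expansion z f) = 0"
  proof -
    have "poly p (expansion z f) = (\<Sum>i\<le>n. expansion z (c i) * expansion z f ^ i)"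
      by (simp add: p_def poly_sum poly_monom)
    also have "\<dots> = (\<Sum>i\<le>n. expansion z (\<lambda>w. c i w * f w ^ i))"
      using an by (intro sum.cong) (simp_all add: expansion_mult expansion_power analytic_on_power)
    also have "\<dots> = expansion z (\<lambda>w. \<Sum>i\<le>n. c i w * f w ^ i)"
      using an by (intro expansion_sum[symmetric] analytic_on_mult analytic_on_power) auto
    also have "\<dots> = expansion z (\<lambda>_. 0)"
      using algebraic.hyps by (intro expansion_cong[OF D(1,3)]) auto
    finally show ?thesis by (simp add: expansion_const)
  qed
  ultimately have "expansion z f \<in> acl K'" unfolding acl_def by blast
  then show ?case using K' by (auto simp: fls.dclosed_def)
next
  case (exponential f)
  have hol: "f holomorphic_on D" using exponential.hyps by (rule elementary_holo_imp_holomorphic)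
  have "(\<lambda>w. exp (f w)) holomorphic_on D" using hol by (intro holomorphic_intros)
  then have an: "f analytic_on {z}" "(\<lambda>w. exp (f w)) analytic_on {z}"
    using hol D analytic_at by blast+
  obtain K1 where K1: "fls.dclosed K1" "s \<notin> K1" "K \<subseteq> K1" "expansion z f \<in> K1"
    using exponential.IH[OF exponential.prems] by blast
  have "fls_deriv (expansion z (\<lambda>w. exp (f w))) = expansion z (deriv (\<lambda>w. exp (f w)))"
    by (intro expansion_deriv[symmetric] an)
  also have "\<dots> = expansion z (\<lambda>w. deriv f w * exp (f w))"
  proof (rule expansion_cong[OF D(1,3)])
    fix w assume "w \<in> D"
    then have "(f has_field_derivative deriv f w) (at w)"
      by (rule holomorphic_derivI[OF hol D(1)])
    then show "deriv (\<lambda>w. exp (f w)) w = deriv f w * exp (f w)"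
      by (intro DERIV_imp_deriv) (auto intro!: derivative_eq_intros)
  qed
  also have "\<dots> = fls_deriv (expansion z f) * expansion z (\<lambda>w. exp (f w))"
    using an by (simp add: expansion_mult expansion_deriv analytic_deriv)
  finally have "fls_deriv (expansion z (\<lambda>w. exp (f w))) = fls_deriv (expansion z f) * expansion z (\<lambda>w. exp (f w))" .
  moreover have "fls_deriv (expansion z f) \<in> K1"
    using K1 by (auto simp: fls.dclosed_def fls.dsubfield_def)
  ultimately obtain K2 where "fls.dclosed K2" "s \<notin> K2" "K1 \<subseteq> K2" "expansion z (\<lambda>w. exp (f w)) \<in> K2"
    using adjoin_log_exp[OF K1(1,2) _ not_exceptional] by metis
  then show ?case using K1 by blast
next
  case (logarithm g f)
  have hol: "f holomorphic_on D" "g holomorphic_on D"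
    using logarithm.hyps by (auto intro: elementary_holo_imp_holomorphic)
  have an: "f analytic_on {z}" "g analytic_on {z}" using hol D analytic_at by blast+
  obtain K1 where K1: "fls.dclosed K1" "s \<notin> K1" "K \<subseteq> K1" "expansion z g \<in> K1"
    using logarithm.IH[OF logarithm.prems] by blast
  have "fls_deriv (expansion z g) = expansion z (deriv g)"
    by (intro expansion_deriv[symmetric] an)
  also have "\<dots> = expansion z (\<lambda>w. deriv f w * g w)"
  proof (rule expansion_cong[OF D(1,3)])
    fix w assume w: "w \<in> D"
    then have "(f has_field_derivative deriv f w) (at w)"
      by (rule holomorphic_derivI[OF hol(1) D(1)])
    then have "((\<lambda>w. exp (f w)) has_field_derivative deriv f w * g w) (at w)"
      using w logarithm.hyps by (auto intro!: derivative_eq_intros)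
    then have "(g has_field_derivative deriv f w * g w) (at w)"
      by (rule has_field_derivative_transform_within_open[OF _ D(1) w]) (use logarithm.hyps in auto)
    then show "deriv g w = deriv f w * g w" by (rule DERIV_imp_deriv)
  qed
  also have "\<dots> = fls_deriv (expansion z f) * expansion z g"
    using an by (simp add: expansion_mult expansion_deriv analytic_deriv)
  finally have "fls_deriv (expansion z g) = fls_deriv (expansion z f) * expansion z g" .
  moreover have "g z \<noteq> 0" using logarithm.hyps D(3) by (metis exp_not_eq_zero)
  then have "expansion z g \<noteq> 0"
    using expansion_eq_0_imp[OF D hol(2) _ D(3)] by blast
  ultimately have "fls_deriv (expansion z f) = fls_deriv (expansion z g) / expansion z g"
    by (simp add: field_simps)
  also have "\<dots> \<in> K1"
    using K1 is_subfieldD(9)[of K1] by (auto simp: fls.dclosed_def fls.dsubfield_def)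
  finally obtain K2 where "fls.dclosed K2" "s \<notin> K2" "K1 \<subseteq> K2" "expansion z f \<in> K2"
    using adjoin_log_exp[OF K1(1,2) _ not_exceptional] by metis
  then show ?case using K1 by blast
qed

text \<open>A field of the tower containing \<open>s ^ B\<close> would contain \<open>s\<close>, a
  root of \<open>X ^ B - s ^ B\<close>. The tower can start at the constants because
  \<open>s\<close> is not one of them.\<close>

lemma power_root_not_elementary:
  assumes "elementary_holo D f" "open D" "connected D" "z \<in> D" and "fls_deriv s \<noteq> 0"
  shows "s ^ B \<noteq> expansion z f"
proof
  assume eq: "s ^ B = expansion z f"
  have "s \<notin> fls.constants" using assms(5) by (simp add: fls.constants_def)
  then obtain K where K: "fls.dclosed K" "s \<notin> K" "expansion z f \<in> K"
    using expansion_in_tower[OF assms(1-4) fls.dclosed_constants] by blast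
  have K': "is_subfield K" using K(1) by (auto simp: fls.dclosed_def fls.dsubfield_def)
  have "monom 1 B - [:s ^ B:] \<in> polys K"
    using K(3) eq is_subfieldD[OF K'] by (intro polys_diff K' polys_const) (auto simp: polys_def)
  moreover have "poly (monom 1 B - [:s ^ B:]) s = 0" by (simp add: poly_monom)
  moreover have "coeff (monom 1 B - [:s ^ B:]) B \<noteq> 0" using AB(2) by (cases B) simp_all
  then have "monom 1 B - [:s ^ B:] \<noteq> 0" by (metis coeff_0)
  ultimately have "s \<in> acl K" unfolding acl_def by blast
  then show False using K by (auto simp: fls.dclosed_def)
qed

end

section \<open>The initial value problem\<close>

lemma primitive_root_of_unity:
  assumes "A > 0"
  obtains w :: complex where "w ^ A = 1" "\<And>k. w ^ k = 1 \<Longrightarrow> A dvd k"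
proof
  define w where "w = exp (2 * of_real pi * \<i> * of_nat 1 / of_nat A)"
  have w: "w ^ k = exp (2 * of_real pi * \<i> * of_nat k / of_nat A)" for k
    by (simp add: w_def exp_of_nat_mult[symmetric] mult_ac)
  show "w ^ A = 1" using complex_root_unity_eq_1[of A A] assms by (simp add: w)
  show "A dvd k" if "w ^ k = 1" for k using complex_root_unity_eq_1[of A k] assms that by (simp add: w)
qed

text \<open>The identity principle carries the differential equation from a real interval over to a complex disc.\<close>

lemma holomorphic_root_of_solution:
  fixes C t0 :: real and A B :: nat and y :: "real \<Rightarrow> real" and F :: "complex \<Rightarrow> complex"
  assumes AB: "A > 0" "B > 0"
    and D: "open D" "F holomorphic_on D" "of_real t0 \<in> D"
    and J: "open J" "t0 \<in> J" "\<And>t. t \<in> J \<Longrightarrow> F (of_real t) = of_real (y t)"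
    and y: "\<And>t. t \<in> J \<Longrightarrow> y t > 0"
      "\<And>t. t \<in> J \<Longrightarrow> (y has_real_derivative C * (1 - y t powr (A / B))) (at t)"
  obtains S U where "open U" "of_real t0 \<in> U" "U \<subseteq> D" "S holomorphic_on U"
    "\<And>z. z \<in> U \<Longrightarrow> S z ^ B = F z" "\<And>z. z \<in> U \<Longrightarrow> deriv F z = of_real C * (1 - S z ^ A)"
proof -
  define z0 where "z0 = complex_of_real t0"
  \<comment> \<open>Here \<open>F\<close> avoids the closed negative axis, so the principal
    logarithm gives a holomorphic \<open>B\<close>-th root that is positive where \<open>F\<close>
    is positive.\<close>
  define D' where "D' = D \<inter> F -` (- \<real>\<^sub>\<le>\<^sub>0)"
  have "open D'"
    unfolding D'_def using D by (intro continuous_open_preimage holomorphic_on_imp_continuous_on) auto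
  moreover have "z0 \<in> D'"
    using D(3) J y(1)[OF J(2)] by (auto simp: D'_def z0_def complex_nonpos_Reals_iff)
  ultimately obtain r1 where r1: "r1 > 0" "ball z0 r1 \<subseteq> D'" by (auto simp: open_contains_ball)
  obtain r2 where r2: "r2 > 0" "ball t0 r2 \<subseteq> J" using J(1,2) by (auto simp: open_contains_ball)
  define r where "r = min r1 r2"
  define U where "U = ball z0 r"
  have r: "r > 0" "U \<subseteq> D'" "ball t0 r \<subseteq> J" using r1 r2 by (auto simp: r_def U_def)
  define S where "S z = exp (Ln (F z) / of_nat B)" for z
  have F_hol: "F holomorphic_on U" by (rule holomorphic_on_subset[OF D(2)]) (use r in \<open>auto simp: D'_def\<close>)
  have F_nonpos: "F z \<notin> \<real>\<^sub>\<le>\<^sub>0" if "z \<in> U" for z using that r by (auto simp: D'_def)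
  then have F_nz: "F z \<noteq> 0" if "z \<in> U" for z using that by force
  have S_hol: "S holomorphic_on U"
    unfolding S_def using F_nonpos F_hol AB by (intro holomorphic_intros) auto
  have S_B: "S z ^ B = F z" if "z \<in> U" for z
    using AB F_nz[OF that] by (simp add: S_def exp_of_nat_mult[symmetric])
  \<comment> \<open>The defect of the differential equation: holomorphic on the disc and zero on its
    real diameter.\<close>
  define H where "H z = deriv F z - of_real C * (1 - S z ^ A)" for z
  have H_hol: "H holomorphic_on U"
    unfolding H_def using F_hol S_hol by (intro holomorphic_intros) (auto simp: U_def)
  have H_real: "H (of_real t) = 0" if t: "t \<in> ball t0 r" for t
  proof -
    have tJ: "t \<in> J" and tU: "complex_of_real t \<in> U"
      using t r by (auto simp: U_def z0_def dist_of_real)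
    note yt = y(1)[OF tJ]
    have "S (of_real t) = of_real (exp (ln (y t) / B))"
      using J(3)[OF tJ] yt by (simp add: S_def Ln_of_real flip: exp_of_real)
    then have "S (of_real t) ^ A = of_real (exp (ln (y t) / B) ^ A)" by simp
    also have "exp (ln (y t) / B) ^ A = y t powr (A / B)"
      using yt by (simp add: powr_def exp_of_nat_mult[symmetric])
    finally have SA: "S (of_real t) ^ A = of_real (y t powr (A / B))" .
    have "(F has_field_derivative deriv F (of_real t)) (at (of_real t))"
      using F_hol tU by (intro holomorphic_derivI[of F U]) (auto simp: U_def)
    then have "((\<lambda>x. F (of_real x)) has_vector_derivative deriv F (of_real t)) (at t)"
      by (rule has_vector_derivative_real_field)
    moreover have "((\<lambda>x. F (of_real x)) has_vector_derivative of_real (C * (1 - y t powr (A / B)))) (at t)"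
    proof (rule has_vector_derivative_transform_within_open[OF _ J(1) tJ])
      show "((\<lambda>x. complex_of_real (y x)) has_vector_derivative of_real (C * (1 - y t powr (A / B)))) (at t)"
        by (intro has_vector_derivative_of_real y(2) tJ)
    qed (use J(3) in simp)
    ultimately have "deriv F (of_real t) = of_real (C * (1 - y t powr (A / B)))"
      by (rule vector_derivative_unique_at)
    then show ?thesis by (simp add: H_def SA)
  qed
  have "z0 islimpt of_real ` ball t0 r"
    unfolding islimpt_approachable
  proof (intro allI impI)
    fix e :: real assume "e > 0"
    define d where "d = min (e / 2) (r / 2)"
    have "d > 0" "d < e" "d < r" using \<open>e > 0\<close> r(1) by (auto simp: d_def min_def)
    then show "\<exists>x'\<in>of_real ` ball t0 r. x' \<noteq> z0 \<and> dist x' z0 < e"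
      by (intro bexI[of _ "of_real (t0 + d)"] imageI) (auto simp: z0_def dist_norm norm_minus_commute)
  qed
  moreover have "of_real ` ball t0 r \<subseteq> U" by (auto simp: U_def z0_def dist_of_real)
  moreover have "H w = 0" if "w \<in> of_real ` ball t0 r" for w using that H_real by blast
  moreover have "open U" "connected U" "z0 \<in> U" using r(1) by (simp_all add: U_def)
  ultimately have "H z = 0" if "z \<in> U" for z
    using analytic_continuation[OF H_hol, of "of_real ` ball t0 r" z0 z] that by blast
  then show ?thesis
    using that[of U S] r S_hol S_B by (auto simp: U_def z0_def D'_def H_def)
qed

text \<open>Positivity of \<open>y\<close> provides the holomorphic root, and \<open>y < 1\<close>
  keeps that root from being constant.\<close>

lemma elementary_solution_exponents:
  fixes C t0 :: real and A B :: nat and y :: "real \<Rightarrow> real" and F :: "complex \<Rightarrow> complex"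
  assumes C: "C \<noteq> 0" and AB: "A > 0" "B > 0" "coprime A B"
    and D: "open D" "connected D" "elementary_holo D F" "of_real t0 \<in> D"
    and J: "open J" "t0 \<in> J" "\<And>t. t \<in> J \<Longrightarrow> F (of_real t) = of_real (y t)"
    and y: "\<And>t. t \<in> J \<Longrightarrow> 0 < y t \<and> y t < 1"
      "\<And>t. t \<in> J \<Longrightarrow> (y has_real_derivative C * (1 - y t powr (A / B))) (at t)"
  shows "A \<in> {1, 2} \<and> B = 1"
proof (rule ccontr)
  assume not_exceptional: "\<not> (A \<in> {1, 2} \<and> B = 1)"
  define z0 where "z0 = complex_of_real t0"
  have F_hol: "F holomorphic_on D" using D(3) by (rule elementary_holo_imp_holomorphic)
  obtain S U where U: "open U" "z0 \<in> U" "U \<subseteq> D" and S: "S holomorphic_on U"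
    "\<And>z. z \<in> U \<Longrightarrow> S z ^ B = F z" "\<And>z. z \<in> U \<Longrightarrow> deriv F z = of_real C * (1 - S z ^ A)"
    using holomorphic_root_of_solution[OF AB(1,2) D(1) F_hol D(4) J _ y(2)] y(1)
    unfolding z0_def by (metis (no_types, lifting))
  have S_an: "S analytic_on {z0}" and F_an: "F analytic_on {z0}"
    using U S(1) F_hol D(1) analytic_at by blast+
  define s where "s = expansion z0 S"
  define c where "c = fls_const (complex_of_real C)"
  have s_B: "s ^ B = expansion z0 F"
    unfolding s_def using expansion_cong[OF U(1,2), of "\<lambda>z. S z ^ B" F] S(2) by (simp add: expansion_power S_an)
  have "fls_deriv (expansion z0 F) = expansion z0 (\<lambda>z. of_real C * (1 - S z ^ A))"
    using expansion_cong[OF U(1,2), of "deriv F"] S(3) expansion_deriv[OF F_an] by simp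
  also have "\<dots> = c * (1 - s ^ A)"
    using S_an by (simp add: expansion_mult expansion_diff expansion_power expansion_const
        analytic_on_diff analytic_on_power c_def s_def)
  finally have ode: "of_nat B * s ^ (B - 1) * fls_deriv s = c * (1 - s ^ A)"
    by (simp add: s_B[symmetric] fls.D_power)
  obtain w :: complex where w: "w ^ A = 1" "\<And>k. w ^ k = 1 \<Longrightarrow> A dvd k"
    using primitive_root_of_unity[OF AB(1)] by blast
  have const_power: "fls_const w ^ k = fls_const (w ^ k)" for k
    by (induction k) (simp_all add: fls_const_mult_const)
  interpret root_equation_fls A B c s "fls_const w"
  proof
    show "c \<noteq> 0" "fls_deriv c = 0" using C by (simp_all add: c_def)
    show "fls_const w ^ A = 1" by (simp add: const_power w)
    show "A dvd k" if "fls_const w ^ k = 1" for k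
      using that w(2) by (simp add: const_power)
  qed (use AB ode not_exceptional in auto)
  \<comment> \<open>A constant \<open>s\<close> would satisfy \<open>s ^ A = 1\<close>; then
    \<open>S z0\<close> has norm 1, and so does its power \<open>y t0\<close>, against
    \<open>y t0 < 1\<close>.\<close>
  have "fls_deriv s \<noteq> 0"
  proof
    assume "fls_deriv s = 0"
    then have "1 - s ^ A = 0" using ode c by simp
    then have "expansion z0 (\<lambda>z. 1 - S z ^ A) = 0"
      using S_an by (simp add: expansion_diff expansion_power expansion_const analytic_on_power s_def)
    obtain r where r: "r > 0" "ball z0 r \<subseteq> U" using U by (auto simp: open_contains_ball)
    have "(\<lambda>z. 1 - S z ^ A) holomorphic_on ball z0 r"
      using holomorphic_on_subset[OF S(1) r(2)] by (intro holomorphic_intros)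
    then have "1 - S z0 ^ A = 0"
      using expansion_eq_0_imp[of "ball z0 r" z0 "\<lambda>z. 1 - S z ^ A" z0] r \<open>expansion z0 (\<lambda>z. 1 - S z ^ A) = 0\<close> by auto
    then have "S z0 ^ A = 1" by simp
    then have "norm (S z0) ^ A = 1" by (metis norm_one norm_power)
    then have "norm (S z0) = 1" using AB(1) power_eq_iff_eq_base[of A "norm (S z0)" 1] by simp
    moreover have "norm (S z0) ^ B = y t0"
      using S(2)[OF U(2)] J(3)[OF J(2), folded z0_def] y(1)[OF J(2)] by (simp flip: norm_power)
    ultimately show False using y(1)[OF J(2)] by simp
  qed
  from power_root_not_elementary[OF D(3,1,2) D(4)[folded z0_def] this] show False using s_B by simp
qed

section \<open>Elementarity and explicit form of the solutions for the exponents 1 and 2\<close>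

lemmas elementary_holo_arith_intros =
  elementary_holo.const elementary_holo.ident elementary_holo.add elementary_holo.diff
  elementary_holo.mult elementary_holo.divide elementary_holo.exponential

lemma elementary_on_1_minus_exp: "elementary_on J (\<lambda>t. 1 - exp (- C * t))"
proof -
  have "elementary_holo UNIV (\<lambda>z. 1 - exp (of_real (- C) * z))"
    by (intro elementary_holo_arith_intros)
  moreover have "1 - exp (of_real (- C) * of_real t) = complex_of_real (1 - exp (- C * t))" for t
    by (simp flip: exp_of_real)
  ultimately show ?thesis
    unfolding elementary_on_def using open_UNIV connected_UNIV by blast
qed

text \<open>On the strip where \<open>Im (2 C z)\<close> lies between \<open>- pi\<close> and \<open>pi\<close>, \<open>exp (2 C z)\<close> avoids \<open>- 1\<close>.\<close>

lemma elementary_on_tanh: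
  assumes "C > 0"
  shows "elementary_on J (\<lambda>t. tanh (C * t))"
proof -
  define D where "D = {z. - (pi / (2 * C)) < Im z} \<inter> {z. Im z < pi / (2 * C)}"
  define E where "E z = exp (of_real (2 * C) * z)" for z :: complex
  have E_nz: "E z + 1 \<noteq> 0" if "z \<in> D" for z
  proof
    assume "E z + 1 = 0"
    then have E: "E z = - 1" by (simp add: eq_neg_iff_add_eq_0)
    have bound: "\<bar>2 * C * Im z\<bar> < pi" using that assms by (auto simp: D_def abs_less_iff field_simps)
    have "norm (E z) = 1" by (simp add: E)
    then have "Re z = 0" using assms by (simp add: E_def)
    then have "cos (2 * C * Im z) = - 1" using arg_cong[OF E, of Re] by (simp add: E_def Re_exp)
    then have "cos \<bar>2 * C * Im z\<bar> = cos pi" by simp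
    from cos_inj_pi[OF _ _ _ _ this] have "\<bar>2 * C * Im z\<bar> = pi" using bound by simp
    then show False using bound by simp
  qed
  have "elementary_holo D (\<lambda>z. (E z - 1) / (E z + 1))"
    using E_nz unfolding E_def by (intro elementary_holo_arith_intros) auto
  moreover have "open D"
    unfolding D_def by (intro open_Int open_halfspace_Im_gt open_halfspace_Im_lt)
  moreover have "connected D"
    unfolding D_def by (intro convex_connected convex_Int convex_halfspace_Im_gt convex_halfspace_Im_lt)
  moreover have "of_real ` J \<subseteq> D" using assms by (auto simp: D_def)
  moreover have "(E (of_real t) - 1) / (E (of_real t) + 1) = of_real (tanh (C * t))" for t
  proof -
    have "tanh (C * t) = (exp (2 * C * t) - 1) / (exp (2 * C * t) + 1)"
      using exp_gt_zero[of "2 * C * t"] by (simp add: tanh_real_altdef exp_minus divide_simps mult.assoc)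
    moreover have "E (of_real t) = of_real (exp (2 * C * t))"
      by (simp add: E_def exp_of_real[symmetric])
    ultimately show ?thesis by simp
  qed
  ultimately show ?thesis unfolding elementary_on_def by blast
qed

lemma elementary_on_cong: "(\<And>t. t \<in> J \<Longrightarrow> f t = g t) \<Longrightarrow> elementary_on J f \<longleftrightarrow> elementary_on J g"
  by (simp add: elementary_on_def)

text \<open>Integrating factor: \<open>(1 - y) * exp (C * t)\<close> has derivative zero on the
  closed half-line.\<close>

lemma solution_linear:
  fixes C :: real and y :: "real \<Rightarrow> real"
  assumes ode: "\<And>t. t \<ge> 0 \<Longrightarrow> (y has_real_derivative C * (1 - y t)) (at t within {0..})"
    and "y 0 = 0" "t \<ge> 0"
  shows "y t = 1 - exp (- C * t)"
proof -
  have "((\<lambda>t. (1 - y t) * exp (C * t)) has_real_derivative 0) (at x within {0..})" if "x \<in> {0..}" for x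
    using that by (auto intro!: derivative_eq_intros ode)
  from has_field_derivative_zero_constant[OF convex_real_interval(1) this]
  obtain k where k: "\<And>x. x \<in> {0..} \<Longrightarrow> (1 - y x) * exp (C * x) = k" by blast
  have "k = 1" using k[of 0] assms(2) by simp
  then show ?thesis using k[of t] assms(3) by (simp add: exp_minus field_simps)
qed

text \<open>Separation of variables suggests the first integral \<open>h\<close>; the bound on
  \<open>y\<close> keeps its denominator nonzero.\<close>

lemma solution_quadratic:
  fixes C :: real and y :: "real \<Rightarrow> real"
  assumes ode: "\<And>t. t \<ge> 0 \<Longrightarrow> (y has_real_derivative C * (1 - (y t)\<^sup>2)) (at t within {0..})"
    and y: "\<And>t. t \<ge> 0 \<Longrightarrow> \<bar>y t\<bar> < 1" and "y 0 = 0" "t \<ge> 0"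
  shows "y t = tanh (C * t)"
proof -
  define h where "h t = (1 + y t) / (1 - y t) * exp (- 2 * (C * t))" for t
  have "(h has_real_derivative 0) (at x within {0..})" if "x \<in> {0..}" for x
  proof -
    have "1 - y x \<noteq> 0" using y[of x] that by auto
    then show ?thesis
      using that unfolding h_def
      by (auto intro!: derivative_eq_intros ode) (simp add: field_simps power2_eq_square)
  qed
  from has_field_derivative_zero_constant[OF convex_real_interval(1) this]
  obtain k where k: "\<And>x. x \<in> {0..} \<Longrightarrow> h x = k" by blast
  have "k = 1" using k[of 0] assms(3) by (simp add: h_def)
  then have "h t = 1" using k[of t] assms(4) by simp
  moreover define e where "e = exp (- 2 * (C * t))"
  moreover have "1 - y t \<noteq> 0" using y[OF assms(4)] by auto
  ultimately have "(1 + y t) * e = 1 - y t" by (simp add: h_def field_simps)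
  then have "y t * (1 + e) = 1 - e" by (simp add: algebra_simps)
  moreover have "1 + e > 0" by (simp add: e_def add_pos_pos)
  ultimately have "y t = (1 - e) / (1 + e)" by (simp add: field_simps)
  then show ?thesis by (simp add: tanh_real_altdef e_def)
qed

theorem theorem7:
  fixes C \<alpha> :: real and A B :: nat and y :: "real \<Rightarrow> real"
  assumes C_pos: "C > 0"
    and AB_pos: "A > 0" "B > 0"
    and AB_coprime: "coprime A B"
    and alpha: "\<alpha> = real A / real B"
    and y_range: "\<And>t. t \<ge> 0 \<Longrightarrow> y t \<in> {0..<1}"
    and y_ode: "\<And>t. t \<ge> 0 \<Longrightarrow>
      (y has_real_derivative C * (1 - y t powr \<alpha>)) (at t within {0..})"
    and y_init: "y 0 = 0"
  shows "(\<forall>J. is_interval J \<and> interior J \<noteq> {} \<and> J \<subseteq> {0..} \<longrightarrow>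
            (elementary_on J y \<longleftrightarrow> \<alpha> \<in> {1, 2}))
       \<and> (\<alpha> = 1 \<longrightarrow> (\<forall>t\<ge>0. y t = 1 - exp (- C * t)))
       \<and> (\<alpha> = 2 \<longrightarrow> (\<forall>t\<ge>0. y t = tanh (C * t)))"
proof -
  have y_le: "y t powr \<alpha> < 1" if "t \<ge> 0" for t
    using y_range[OF that] AB_pos powr_less_mono2[of \<alpha> "y t" 1] by (simp add: alpha)
  have y_at: "(y has_real_derivative C * (1 - y t powr \<alpha>)) (at t)" if "t > 0" for t
  proof -
    have "at t within {0..} = at t" using that by (intro at_within_interior) simp
    then show ?thesis using y_ode[of t] that by simp
  qed
  have y_cont: "continuous_on {0..} y"
    by (rule DERIV_continuous_on[OF y_ode]) simp
  \<comment> \<open>The derivative is positive for positive times, so \<open>y\<close> leaves its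
    initial value 0 at once.\<close>
  have y_pos: "y t > 0" if t: "t > 0" for t
  proof -
    have "y 0 < y t"
    proof (rule DERIV_pos_imp_increasing_open[OF t])
      show "\<exists>d. (y has_real_derivative d) (at x) \<and> d > 0" if "0 < x" for x
        using y_at[OF that] y_le[of x] that C_pos by (intro exI[of _ "C * (1 - y x powr \<alpha>)"]) simp
      show "continuous_on {0..t} y"
        using y_cont by (rule continuous_on_subset) simp
    qed
    then show ?thesis by (simp add: y_init)
  qed
  have linear: "y t = 1 - exp (- C * t)" if "\<alpha> = 1" "t \<ge> 0" for t
  proof (rule solution_linear[of y C t])
    show "(y has_real_derivative C * (1 - y t)) (at t within {0..})" if "t \<ge> 0" for t
      using y_ode[OF that] y_range[OF that] \<open>\<alpha> = 1\<close> by simp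
  qed (use y_init that in auto)
  have quadratic: "y t = tanh (C * t)" if "\<alpha> = 2" "t \<ge> 0" for t
  proof (rule solution_quadratic[of y C t])
    show "(y has_real_derivative C * (1 - (y t)\<^sup>2)) (at t within {0..})" if "t \<ge> 0" for t
      using y_ode[OF that] y_range[OF that] \<open>\<alpha> = 2\<close> by (cases "y t = 0") simp_all
    show "\<bar>y t\<bar> < 1" if "t \<ge> 0" for t using y_range[OF that] by simp
  qed (use y_init that in auto)
  have only_if: "\<alpha> \<in> {1, 2}" if J: "interior J \<noteq> {}" "J \<subseteq> {0..}" and el: "elementary_on J y" for J
  proof -
    obtain D F where D: "open D" "connected D" "complex_of_real ` J \<subseteq> D" "elementary_holo D F"
      "\<And>t. t \<in> J \<Longrightarrow> F (of_real t) = of_real (y t)"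
      using el unfolding elementary_on_def by blast
    obtain t0 where t0: "t0 \<in> interior J" using J(1) by blast
    \<comment> \<open>Passing to the interior of \<open>J\<close> excludes time 0, where
      \<open>y\<close> vanishes and the derivative is only one-sided.\<close>
    have int_J: "t \<in> J" "t > 0" if "t \<in> interior J" for t
      using that interior_subset[of J] interior_mono[OF J(2)] by (auto simp: interior_real_atLeast)
    have "A \<in> {1, 2} \<and> B = 1"
    proof (rule elementary_solution_exponents[of C A B D F t0 "interior J" y])
      show "(y has_real_derivative C * (1 - y t powr (A / B))) (at t)" if "t \<in> interior J" for t
        using y_at[OF int_J(2)[OF that]] alpha by simp
      show "0 < y t \<and> y t < 1" if "t \<in> interior J" for t
        using y_pos[of t] y_range[of t] int_J(2)[OF that] by simp
    qed (use C_pos AB_pos AB_coprime D t0 int_J in auto)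
    then show ?thesis using alpha by auto
  qed
  have "elementary_on J y" if "J \<subseteq> {0..}" "\<alpha> \<in> {1, 2}" for J
  proof (cases "\<alpha> = 1")
    case True
    then have "elementary_on J y \<longleftrightarrow> elementary_on J (\<lambda>t. 1 - exp (- C * t))"
      using that linear by (intro elementary_on_cong) auto
    then show ?thesis using elementary_on_1_minus_exp by blast
  next
    case False
    then have "elementary_on J y \<longleftrightarrow> elementary_on J (\<lambda>t. tanh (C * t))"
      using that quadratic by (intro elementary_on_cong) auto
    then show ?thesis using elementary_on_tanh[OF C_pos] by blast
  qed
  then show ?thesis using only_if linear quadratic by blast
qed

end
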